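(* Consider a $K$-class classification problem with $n$ samples per class, $N=nK$, inputs $x_{k,i}\in\mathbb{R}^d$ ($k\in[K]$, $i\in[n]$) and one-hot labels $y_k=e_k\in\mathbb{R}^K$. Let $X\in\mathbb{R}^{d\times N}$ be the matrix of inputs and $Y\in\mathbb{R}^{K\times N}$ the corresponding label matrix, and suppose $X$ is square ($d=N$) and orthogonal. Consider an $L$-layer linear network with weights $W_l\in\mathbb{R}^{d\times d}$ for $l\in[L-1]$ and $W_L\in\mathbb{R}^{K\times d}$, with $d>2K$. Suppose there is $\varepsilon>0$ with $$\varepsilon\le\min\Big\{\frac{n^{1/(2L)}}{\sqrt{30}\,L\,(d-K)^{1/4}},\ \frac{(n/2)^{1/(4L)}}{(d-K)^{1/4}},\ \frac{1}{\sqrt{2(\sqrt K+1)}}\Big\}$$ such that: (i) (global optimality) $W_{L:1}X=Y$; (ii) (balancedness) $W_{l+1}^\top W_{l+1}=W_lW_l^\top$ for all $l\in[L-2]$, and $\|W_L^\top W_L-W_{L-1}W_{L-1}^\top\|_F\le\varepsilon^2\sqrt{d-K}$; (iii) (unchanged spectrum) there is an index set $\mathcal{A}\subseteq[d]$ with $|\mathcal{A}|=d-2K$ such that $\sigma_i(W_l)=\varepsilon$ for all $i\in\mathcal{A}$ and all $l\in[L-1]$. Then for all $l=0,1,\dots,L-2$, $$D_{l+1}/D_l\le 2(\sqrt K+1)\varepsilon^2.$$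
   Context: $W_{l:1}=W_l\cdots W_1$. Features: $z^l_{k,i}=W_{l:1}x_{k,i}$ for $l\ge1$ and $z^0_{k,i}=x_{k,i}$. Class means $\bar z^l_k=\frac1n\sum_{i=1}^n z^l_{k,i}$, global mean $\bar z^l=\frac1K\sum_{k=1}^K\bar z^l_k$. Within-class and between-class covariances $\Sigma_W^l=\frac1N\sum_{k=1}^K\sum_{i=1}^n(z^l_{k,i}-\bar z^l_k)(z^l_{k,i}-\bar z^l_k)^\top$, $\Sigma_B^l=\frac1K\sum_{k=1}^K(\bar z^l_k-\bar z^l)(\bar z^l_k-\bar z^l)^\top$, and separation measure $D_l=\mathrm{Tr}(\Sigma_W^l)/\mathrm{Tr}(\Sigma_B^l)$. $\sigma_i(A)$ is the $i$-th largest singular value. *)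

theory Defs
  imports "Jordan_Normal_Form.Char_Poly" "HOL-Library.Multiset"
begin

definition mtrace :: "real mat \<Rightarrow> real" where
  "mtrace A = (\<Sum>i<dim_row A. A $$ (i, i))"

definition frob_norm :: "real mat \<Rightarrow> real" where
  "frob_norm A = sqrt (\<Sum>i<dim_row A. \<Sum>j<dim_col A. (A $$ (i, j))\<^sup>2)"

definition singular_values :: "real mat \<Rightarrow> real list" where
  "singular_values A =
     map sqrt (rev (sorted_list_of_multiset (proots (char_poly (transpose_mat A * A)))))"

definition sigma :: "nat \<Rightarrow> real mat \<Rightarrow> real" where
  "sigma i A = singular_values A ! (i - 1)"

fun Wprod :: "nat \<Rightarrow> (nat \<Rightarrow> real mat) \<Rightarrow> nat \<Rightarrow> real mat" where
  "Wprod d W 0 = 1\<^sub>m d"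
| "Wprod d W (Suc l) = W (Suc l) * Wprod d W l"

(* label matrix: column k*n+i is e_k *)
definition label_mat :: "nat \<Rightarrow> nat \<Rightarrow> real mat" where
  "label_mat K n = mat K (n * K) (\<lambda>(r, c). if r = c div n then 1 else 0)"

(* feature z^l_{k,i} = W_{l:1} x_{k,i}, with x_{k,i} the column k*n+i of X (0-indexed k,i) *)
definition feat :: "nat \<Rightarrow> (nat \<Rightarrow> real mat) \<Rightarrow> real mat \<Rightarrow> nat \<Rightarrow> nat \<Rightarrow> nat \<Rightarrow> nat \<Rightarrow> real vec" where
  "feat d W X n l k i = Wprod d W l *\<^sub>v col X (k * n + i)"

definition class_mean :: "nat \<Rightarrow> (nat \<Rightarrow> real mat) \<Rightarrow> real mat \<Rightarrow> nat \<Rightarrow> nat \<Rightarrow> nat \<Rightarrow> real vec" where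
  "class_mean d W X n l k =
     vec (dim_row (Wprod d W l)) (\<lambda>a. (1 / real n) * (\<Sum>i<n. feat d W X n l k i $ a))"

definition global_mean :: "nat \<Rightarrow> (nat \<Rightarrow> real mat) \<Rightarrow> real mat \<Rightarrow> nat \<Rightarrow> nat \<Rightarrow> nat \<Rightarrow> real vec" where
  "global_mean d W X K n l =
     vec (dim_row (Wprod d W l)) (\<lambda>a. (1 / real K) * (\<Sum>k<K. class_mean d W X n l k $ a))"

definition Sigma_W :: "nat \<Rightarrow> (nat \<Rightarrow> real mat) \<Rightarrow> real mat \<Rightarrow> nat \<Rightarrow> nat \<Rightarrow> nat \<Rightarrow> real mat" where
  "Sigma_W d W X K n l =
     mat (dim_row (Wprod d W l)) (dim_row (Wprod d W l)) (\<lambda>(a, b).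
       (1 / real (n * K)) * (\<Sum>k<K. \<Sum>i<n.
          (feat d W X n l k i $ a - class_mean d W X n l k $ a) *
          (feat d W X n l k i $ b - class_mean d W X n l k $ b)))"

definition Sigma_B :: "nat \<Rightarrow> (nat \<Rightarrow> real mat) \<Rightarrow> real mat \<Rightarrow> nat \<Rightarrow> nat \<Rightarrow> nat \<Rightarrow> real mat" where
  "Sigma_B d W X K n l =
     mat (dim_row (Wprod d W l)) (dim_row (Wprod d W l)) (\<lambda>(a, b).
       (1 / real K) * (\<Sum>k<K.
          (class_mean d W X n l k $ a - global_mean d W X K n l $ a) *
          (class_mean d W X n l k $ b - global_mean d W X K n l $ b)))"

definition Dsep :: "nat \<Rightarrow> (nat \<Rightarrow> real mat) \<Rightarrow> real mat \<Rightarrow> nat \<Rightarrow> nat \<Rightarrow> nat \<Rightarrow> real" where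
  "Dsep d W X K n l = mtrace (Sigma_W d W X K n l) / mtrace (Sigma_B d W X K n l)"

end

theory Submission
  imports Defs "Jordan_Normal_Form.Spectral_Radius"
begin

text \<open>
  Put \<open>Z\<^sub>l = W\<^sub>l \<dots> W\<^sub>1\<close>, \<open>G = W\<^sub>1\<^sup>T W\<^sub>1\<close>, \<open>H = W\<^sub>L\<^sub>-\<^sub>1 W\<^sub>L\<^sub>-\<^sub>1\<^sup>T\<close> and \<open>E = W\<^sub>L\<^sup>T W\<^sub>L - H\<close>. Balancedness gives
  \<open>Z\<^sub>l\<^sup>T Z\<^sub>l = G\<^sup>l\<close>, so the squared norms of the features of a fixed vector form a moment sequence of a
  positive semidefinite matrix, which is log-convex.

  The eigenvalue \<open>- \<epsilon>\<^sup>2\<close> of \<open>E\<close> has multiplicity at least \<open>d - 3 K\<close>, because \<open>H\<close> has the eigenvalue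
  \<open>\<epsilon>\<^sup>2\<close> with multiplicity at least \<open>d - 2 K\<close> and \<open>W\<^sub>L\<close> has rank at most \<open>K\<close>. The Frobenius bound on \<open>E\<close>
  leaves at most \<open>2 K \<epsilon>\<^sup>4\<close> for the squares of the other eigenvalues, so that the operator norm of \<open>E\<close> is
  at most \<open>\<surd>(2 K) \<epsilon>\<^sup>2\<close>.

  A within-class deviation \<open>x\<close> is annihilated by \<open>Z\<^sub>L\<close>. For \<open>y = Z\<^sub>L\<^sub>-\<^sub>1 x\<close> this means
  \<open>x \<bullet> G\<^sup>L x = y \<bullet> H y = - y \<bullet> E y \<le> \<surd>(2 K) \<epsilon>\<^sup>2 (x \<bullet> G\<^sup>L\<^sup>-\<^sup>1 x)\<close>, and by log-convexity the same ratio
  bounds all earlier layers. A centred class mean lies in the range of \<open>Z\<^sub>L\<^sup>T\<close>, and there the norms do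
  not decrease from layer to layer. Hence \<open>D\<^sub>l\<^sub>+\<^sub>1 / D\<^sub>l \<le> \<surd>(2 K) \<epsilon>\<^sup>2\<close>, which is even below the claim.
\<close>

subsection \<open>Diagonalization of real symmetric matrices\<close>

lemma scalar_prod_self_ge_0: "(x :: real vec) \<bullet> x \<ge> 0"
  by (simp add: scalar_prod_def sum_nonneg)

lemma scalar_prod_self_pos:
  "(x :: real vec) \<in> carrier_vec n \<Longrightarrow> x \<noteq> 0\<^sub>v n \<Longrightarrow> x \<bullet> x > 0"
  using conjugate_square_greater_0_vec[of x n] by simp

lemma symmetric_scalar_prod:
  fixes A :: "real mat"
  assumes "A \<in> carrier_mat n n" "transpose_mat A = A" "x \<in> carrier_vec n" "y \<in> carrier_vec n"
  shows "x \<bullet> (A *\<^sub>v y) = (A *\<^sub>v x) \<bullet> y"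
  using transpose_vec_mult_scalar[of A n n y x] assms by simp

text \<open>Over the complex numbers the spectrum is nonempty. A complex eigenvector splits into
  real and imaginary parts \<open>a\<close> and \<open>b\<close>; symmetry forces the eigenvalue to
  be real, so whichever part is nonzero is a real eigenvector.\<close>

lemma symmetric_eigenvector_exists:
  fixes A :: "real mat"
  assumes A: "A \<in> carrier_mat n n" and sym: "transpose_mat A = A" and n: "n > 0"
  shows "\<exists>v r. v \<in> carrier_vec n \<and> v \<noteq> 0\<^sub>v n \<and> A *\<^sub>v v = r \<cdot>\<^sub>v v"
proof -
  let ?C = "map_mat complex_of_real A"
  have C: "?C \<in> carrier_mat n n" using A by simp
  from spectrum_non_empty[OF C n] obtain z where "eigenvalue ?C z"
    unfolding spectrum_def by auto
  then obtain v where v: "v \<in> carrier_vec n" "v \<noteq> 0\<^sub>v n" "?C *\<^sub>v v = z \<cdot>\<^sub>v v"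
    unfolding eigenvalue_def eigenvector_def using A by auto
  define a where "a = map_vec Re v"
  define b where "b = map_vec Im v"
  have a: "a \<in> carrier_vec n" and b: "b \<in> carrier_vec n"
    using v(1) by (auto simp: a_def b_def)
  have row: "(\<Sum>j<n. complex_of_real (A $$ (i, j)) * v $ j) = z * v $ i" if i: "i < n" for i
  proof -
    have "(?C *\<^sub>v v) $ i = z * v $ i" unfolding v(3) using v(1) i by simp
    then show ?thesis
      using i A v(1) by (simp add: scalar_prod_def atLeast0LessThan)
  qed
  have Aa: "A *\<^sub>v a = Re z \<cdot>\<^sub>v a - Im z \<cdot>\<^sub>v b"
  proof (rule eq_vecI)
    fix i assume "i < dim_vec (Re z \<cdot>\<^sub>v a - Im z \<cdot>\<^sub>v b)"
    then have i: "i < n" using b by simp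
    have "(A *\<^sub>v a) $ i = (\<Sum>j<n. A $$ (i, j) * Re (v $ j))"
      using i A v(1) by (simp add: scalar_prod_def atLeast0LessThan a_def)
    also have "\<dots> = Re (\<Sum>j<n. complex_of_real (A $$ (i, j)) * v $ j)" by simp
    also have "\<dots> = Re (z * v $ i)" using row[OF i] by simp
    finally show "(A *\<^sub>v a) $ i = (Re z \<cdot>\<^sub>v a - Im z \<cdot>\<^sub>v b) $ i"
      using i v(1) by (simp add: a_def b_def)
  qed (use A b in auto)
  have Ab: "A *\<^sub>v b = Re z \<cdot>\<^sub>v b + Im z \<cdot>\<^sub>v a"
  proof (rule eq_vecI)
    fix i assume "i < dim_vec (Re z \<cdot>\<^sub>v b + Im z \<cdot>\<^sub>v a)"
    then have i: "i < n" using a by simp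
    have "(A *\<^sub>v b) $ i = (\<Sum>j<n. A $$ (i, j) * Im (v $ j))"
      using i A v(1) by (simp add: scalar_prod_def atLeast0LessThan b_def)
    also have "\<dots> = Im (\<Sum>j<n. complex_of_real (A $$ (i, j)) * v $ j)" by simp
    also have "\<dots> = Im (z * v $ i)" using row[OF i] by simp
    finally show "(A *\<^sub>v b) $ i = (Re z \<cdot>\<^sub>v b + Im z \<cdot>\<^sub>v a) $ i"
      using i v(1) by (simp add: a_def b_def)
  qed (use A a in auto)
  have nz: "a \<noteq> 0\<^sub>v n \<or> b \<noteq> 0\<^sub>v n"
  proof (rule ccontr)
    assume "\<not> ?thesis"
    then have "Re (v $ i) = 0" "Im (v $ i) = 0" if "i < n" for i
      using that v(1) by (auto simp: a_def b_def vec_eq_iff)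
    then have "v = 0\<^sub>v n" using v(1) by (auto simp: complex_eq_iff)
    with v(2) show False by simp
  qed
  have "a \<bullet> a + b \<bullet> b > 0"
    using nz scalar_prod_self_pos[OF a] scalar_prod_self_pos[OF b]
      scalar_prod_self_ge_0[of a] scalar_prod_self_ge_0[of b] by linarith
  \<comment> \<open>Evaluating the bilinear form at \<open>a\<close> and \<open>b\<close> from both
    sides produces the same term \<open>Re z * (a \<bullet> b)\<close> twice, so only the multiples
    of \<open>Im z\<close> survive.\<close>
  moreover have "Im z * (a \<bullet> a + b \<bullet> b) = 0"
  proof -
    have "a \<bullet> (A *\<^sub>v b) = (A *\<^sub>v a) \<bullet> b" by (rule symmetric_scalar_prod[OF A sym a b])
    moreover have "a \<bullet> (A *\<^sub>v b) = Re z * (a \<bullet> b) + Im z * (a \<bullet> a)"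
      unfolding Ab using a b by (simp add: scalar_prod_add_distrib[of _ n])
    moreover have "(A *\<^sub>v a) \<bullet> b = Re z * (a \<bullet> b) - Im z * (b \<bullet> b)"
      unfolding Aa using a b by (simp add: minus_scalar_prod_distrib[of _ n])
    ultimately show ?thesis by (simp add: algebra_simps)
  qed
  ultimately have "Im z = 0" by simp
  then have "A *\<^sub>v a = Re z \<cdot>\<^sub>v a" "A *\<^sub>v b = Re z \<cdot>\<^sub>v b"
    unfolding Aa Ab using a b by (auto simp: vec_eq_iff)
  then show ?thesis using nz a b by blast
qed

text \<open>The Householder reflection that exchanges \<open>v\<close> and the first unit vector.\<close>

lemma unit_vec_extends_to_orthogonal:
  fixes v :: "real vec"
  assumes v: "v \<in> carrier_vec (Suc n)" and unit: "v \<bullet> v = 1"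
  shows "\<exists>V \<in> carrier_mat (Suc n) (Suc n). transpose_mat V = V \<and> V * V = 1\<^sub>m (Suc n)
           \<and> V *\<^sub>v unit_vec (Suc n) 0 = v"
proof (cases "v = unit_vec (Suc n) 0")
  case True
  then show ?thesis by (intro bexI[of _ "1\<^sub>m (Suc n)"]) auto
next
  case False
  let ?N = "Suc n"
  define w where "w = v - unit_vec ?N 0"
  have w: "w \<in> carrier_vec ?N" using v by (simp add: w_def)
  have "w \<noteq> 0\<^sub>v ?N" using False v by (auto simp: w_def vec_eq_iff)
  then have wpos: "w \<bullet> w > 0" using scalar_prod_self_pos[OF w] by simp
  define c where "c = 2 / (w \<bullet> w)"
  define V where "V = mat ?N ?N (\<lambda>(i, j). (if i = j then 1 else 0) - c * w $ i * w $ j)"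
  have V: "V \<in> carrier_mat ?N ?N" by (simp add: V_def)
  have ww: "w \<bullet> w = (\<Sum>k<?N. w $ k * w $ k)"
    using w by (simp add: scalar_prod_def atLeast0LessThan)
  have cw: "c * (w \<bullet> w) = 2" using wpos by (simp add: c_def)
  \<comment> \<open>Since \<open>v\<close> has length 1, |v - e_0|^2 = 2 - 2 v_0 = -2 w_0. Hence
    \<open>c * w $ 0 = -1\<close>, and column 0 of \<open>V\<close> is e_0 + w = v.\<close>
  have ww2: "w \<bullet> w = - 2 * w $ 0"
  proof -
    have "w \<bullet> w = v \<bullet> v - 2 * v $ 0 + 1"
      unfolding w_def using v
      by (simp add: scalar_prod_minus_distrib[of _ ?N] minus_scalar_prod_distrib[of _ ?N])
    then show ?thesis using unit v by (simp add: w_def)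
  qed
  have cw0: "c * w $ 0 = -1" using cw ww2 by (simp add: algebra_simps)
  have "transpose_mat V = V" by (rule eq_matI) (auto simp: V_def)
  moreover have "V * V = 1\<^sub>m ?N"
  proof (rule eq_matI)
    fix i j assume "i < dim_row (1\<^sub>m ?N)" "j < dim_col (1\<^sub>m ?N)"
    then have i: "i < ?N" and j: "j < ?N" by auto
    have "(V * V) $$ (i, j)
        = (\<Sum>k<?N. ((if i = k then 1 else 0) - c * w $ i * w $ k) *
                       ((if k = j then 1 else 0) - c * w $ k * w $ j))"
      using i j by (simp add: V_def scalar_prod_def atLeast0LessThan)
    \<comment> \<open>The two factors are multiplied out so that each Kronecker delta is summed
      separately. The quadratic term carries |w|^2 and, as c |w|^2 = 2, cancels the two linear
      ones.\<close>
    also have "\<dots> = (\<Sum>k<?N. (if k = i then (if i = j then 1 else 0) else 0)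
        - (if k = i then c * w $ i * w $ j else 0) - (if k = j then c * w $ i * w $ j else 0)
        + c * c * w $ i * w $ j * (w $ k * w $ k))"
      by (rule sum.cong) (auto simp: algebra_simps)
    also have "\<dots> = (if i = j then 1 else 0) - 2 * (c * w $ i * w $ j)
        + c * c * w $ i * w $ j * (w \<bullet> w)"
      unfolding sum.distrib sum_subtractf sum_distrib_left[symmetric] ww
      using i j by (simp del: sum.lessThan_Suc)
    also have "c * c * w $ i * w $ j * (w \<bullet> w) = (c * (w \<bullet> w)) * (c * w $ i * w $ j)"
      by (simp add: algebra_simps)
    finally show "(V * V) $$ (i, j) = 1\<^sub>m ?N $$ (i, j)" using i j unfolding cw by simp
  qed (auto simp: V_def)
  moreover have "V *\<^sub>v unit_vec ?N 0 = v"
  proof (rule eq_vecI)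
    fix i assume "i < dim_vec v"
    then have i: "i < ?N" using v by simp
    have "(V *\<^sub>v unit_vec ?N 0) $ i = (if i = 0 then 1 else 0) - (c * w $ 0) * w $ i"
      using i V by (simp add: V_def)
    also have "\<dots> = v $ i" unfolding cw0 using i v by (simp add: w_def unit_vec_def)
    finally show "(V *\<^sub>v unit_vec ?N 0) $ i = v $ i" .
  qed (use v V in auto)
  ultimately show ?thesis using V by blast
qed

text \<open>Induction on the dimension: an orthogonal reflection moves a unit eigenvector to the
  first unit vector, symmetry then splits off a 1 by 1 block, and the induction hypothesis
  diagonalizes the rest. The diagonal \<open>s\<close> carries no order.\<close>

lemma symmetric_diagonalization:
  fixes A :: "real mat"
  assumes "A \<in> carrier_mat n n" and "transpose_mat A = A"
  shows "\<exists>Q \<in> carrier_mat n n. \<exists>s. transpose_mat Q * Q = 1\<^sub>m n \<and>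
           transpose_mat Q * A * Q = mat_diag n s"
  using assms
proof (induction n arbitrary: A)
  case 0
  then show ?case by (intro bexI[of _ "1\<^sub>m 0"] exI[of _ "\<lambda>_. 0"] conjI eq_matI)
      (auto simp: mat_diag_def)
next
  case (Suc n)
  let ?N = "Suc n"
  note A = Suc.prems(1) and sym = Suc.prems(2)
  obtain x r where x: "x \<in> carrier_vec ?N" "x \<noteq> 0\<^sub>v ?N" "A *\<^sub>v x = r \<cdot>\<^sub>v x"
    using symmetric_eigenvector_exists[OF A sym] by auto
  define v where "v = (1 / sqrt (x \<bullet> x)) \<cdot>\<^sub>v x"
  have v: "v \<in> carrier_vec ?N" using x by (simp add: v_def)
  have "v \<bullet> v = 1" using x scalar_prod_self_pos[OF x(1,2)] by (simp add: v_def)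
  have Av: "A *\<^sub>v v = r \<cdot>\<^sub>v v"
    using x A by (simp add: v_def mult_mat_vec[OF A x(1)] smult_smult_assoc mult.commute)
  obtain V where V: "V \<in> carrier_mat ?N ?N" and VT: "transpose_mat V = V"
    and VV: "V * V = 1\<^sub>m ?N" and Ve: "V *\<^sub>v unit_vec ?N 0 = v"
    using unit_vec_extends_to_orthogonal[OF v \<open>v \<bullet> v = 1\<close>] by blast
  define B where "B = V * A * V"
  have B: "B \<in> carrier_mat ?N ?N" using V A by (auto simp: B_def)
  have BT: "transpose_mat B = B"
  proof -
    have "transpose_mat B = transpose_mat V * transpose_mat (V * A)"
      unfolding B_def using V A by (intro transpose_mult) auto
    also have "transpose_mat (V * A) = A * V"
      using V A VT sym by (simp add: transpose_mult[of _ ?N ?N])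
    finally show ?thesis unfolding B_def VT using assoc_mult_mat[OF V A V] by simp
  qed
  have Be: "B *\<^sub>v unit_vec ?N 0 = r \<cdot>\<^sub>v unit_vec ?N 0"
  proof -
    have "B *\<^sub>v unit_vec ?N 0 = V *\<^sub>v (A *\<^sub>v (V *\<^sub>v unit_vec ?N 0))"
      unfolding B_def using V A mult_carrier_mat[OF V A]
      by (simp add: assoc_mult_mat_vec[of _ ?N ?N _ ?N])
    also have "\<dots> = r \<cdot>\<^sub>v (V *\<^sub>v v)" unfolding Ve Av by (rule mult_mat_vec[OF V v])
    also have "V *\<^sub>v v = V * V *\<^sub>v unit_vec ?N 0"
      unfolding Ve[symmetric] using V by (simp add: assoc_mult_mat_vec[of _ ?N ?N _ ?N])
    finally show ?thesis unfolding VV by simp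
  qed
  have B0: "B $$ (i, 0) = (if i = 0 then r else 0)" if "i < ?N" for i
  proof -
    have "B $$ (i, 0) = (B *\<^sub>v unit_vec ?N 0) $ i" using B that by simp
    then show ?thesis unfolding Be using that by (auto simp: unit_vec_def)
  qed
  \<comment> \<open>The eigenvector determines the first column; symmetry transfers its zeros to the
    first row, which makes \<open>B\<close> block diagonal.\<close>
  have B0': "B $$ (0, i) = (if i = 0 then r else 0)" if "i < ?N" for i
    using arg_cong[OF BT, of "\<lambda>M. M $$ (i, 0)"] B that B0[OF that] by simp
  define C where "C = mat n n (\<lambda>(i, j). B $$ (Suc i, Suc j))"
  have C: "C \<in> carrier_mat n n" by (simp add: C_def)
  have CT: "transpose_mat C = C"
  proof (rule eq_matI)
    fix i j assume "i < dim_row C" "j < dim_col C"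
    then show "transpose_mat C $$ (i, j) = C $$ (i, j)"
      using arg_cong[OF BT, of "\<lambda>M. M $$ (Suc i, Suc j)"] B by (simp add: C_def)
  qed (simp_all add: C_def)
  have Bb: "B = four_block_mat (mat 1 1 (\<lambda>_. r)) (0\<^sub>m 1 n) (0\<^sub>m n 1) C"
    using B B0 B0' by (intro eq_matI) (auto simp: C_def)
  obtain Q s where Q: "Q \<in> carrier_mat n n" and QQ: "transpose_mat Q * Q = 1\<^sub>m n"
    and QC: "transpose_mat Q * C * Q = mat_diag n s"
    using Suc.IH[OF C CT] by blast
  define R where "R = four_block_mat (1\<^sub>m 1) (0\<^sub>m 1 n) (0\<^sub>m n 1) Q"
  have R: "R \<in> carrier_mat ?N ?N" using Q four_block_carrier_mat[of "1\<^sub>m 1" 1 1 Q n n]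
    by (simp add: R_def)
  have RT: "transpose_mat R = four_block_mat (1\<^sub>m 1) (0\<^sub>m 1 n) (0\<^sub>m n 1) (transpose_mat Q)"
    unfolding R_def using Q by (subst transpose_four_block_mat[of _ 1 1 _ n _ n]) auto
  have RR: "transpose_mat R * R = 1\<^sub>m ?N"
    unfolding RT unfolding R_def using Q
    by (subst mult_four_block_mat[of _ 1 1 _ n _ n _ _ 1 _ n]) (auto simp: QQ)
  have RBR: "transpose_mat R * B * R = mat_diag ?N (case_nat r s)"
  proof -
    have "transpose_mat R * B = four_block_mat (mat 1 1 (\<lambda>_. r)) (0\<^sub>m 1 n) (0\<^sub>m n 1) (transpose_mat Q * C)"
      unfolding RT Bb using Q C
      by (subst mult_four_block_mat[of _ 1 1 _ n _ n _ _ 1 _ n]) auto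
    then have "transpose_mat R * B * R
        = four_block_mat (mat 1 1 (\<lambda>_. r)) (0\<^sub>m 1 n) (0\<^sub>m n 1) (transpose_mat Q * C * Q)"
      unfolding R_def using Q C
      by (simp, subst mult_four_block_mat[of _ 1 1 _ n _ n _ _ 1 _ n]) auto
    also have "\<dots> = mat_diag ?N (case_nat r s)"
      unfolding QC by (rule eq_matI) (auto simp: mat_diag_def split: nat.splits)
    finally show ?thesis .
  qed
  have VRT: "transpose_mat (V * R) = transpose_mat R * V"
    using V R VT by (simp add: transpose_mult[of _ ?N ?N])
  have "transpose_mat (V * R) * (V * R) = transpose_mat R * (V * V) * R"
    unfolding VRT using V R by (simp add: assoc_mult_mat[of _ ?N ?N _ ?N _ ?N])
  also have "\<dots> = 1\<^sub>m ?N" unfolding VV using R RR by simp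
  finally have "transpose_mat (V * R) * (V * R) = 1\<^sub>m ?N" .
  moreover have "transpose_mat (V * R) * A * (V * R) = mat_diag ?N (case_nat r s)"
    unfolding RBR[symmetric] VRT B_def using V R A
    by (simp add: assoc_mult_mat[of _ ?N ?N _ ?N _ ?N])
  ultimately show ?case using V R by (intro bexI[of _ "V * R"] exI[of _ "case_nat r s"]) auto
qed

subsection \<open>Eigenbases and moments\<close>

text \<open>Mutual orthogonality of the \<open>q i\<close> is encoded by Parseval's identity, the
  form in which later sums use it. The factorized characteristic polynomial says that
  \<open>s\<close> lists the eigenvalues with multiplicity, which links \<open>s\<close> to
  \<open>singular_values\<close>.\<close>

definition eigenbasis :: "nat \<Rightarrow> real mat \<Rightarrow> (nat \<Rightarrow> real vec) \<Rightarrow> (nat \<Rightarrow> real) \<Rightarrow> bool" where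
  "eigenbasis n A q s \<longleftrightarrow> A \<in> carrier_mat n n \<and> transpose_mat A = A \<and>
     (\<forall>i<n. q i \<in> carrier_vec n \<and> q i \<bullet> q i = 1 \<and> A *\<^sub>v q i = s i \<cdot>\<^sub>v q i) \<and>
     (\<forall>x \<in> carrier_vec n. \<forall>y \<in> carrier_vec n. x \<bullet> y = (\<Sum>i<n. (q i \<bullet> x) * (q i \<bullet> y))) \<and>
     char_poly A = (\<Prod>a\<leftarrow>map s [0..<n]. [:- a, 1:])"

lemma eigenbasis_exists:
  fixes A :: "real mat"
  assumes A: "A \<in> carrier_mat n n" and sym: "transpose_mat A = A"
  shows "\<exists>q s. eigenbasis n A q s"
proof -
  obtain Q s where Q: "Q \<in> carrier_mat n n" and QQ: "transpose_mat Q * Q = 1\<^sub>m n"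
    and QAQ: "transpose_mat Q * A * Q = mat_diag n s"
    using symmetric_diagonalization[OF A sym] by blast
  have T: "transpose_mat Q \<in> carrier_mat n n" using Q by simp
  have QQ': "Q * transpose_mat Q = 1\<^sub>m n"
    using mat_mult_left_right_inverse[OF T Q QQ] .
  have AQ: "A * Q = Q * mat_diag n s"
  proof -
    have "Q * mat_diag n s = (Q * transpose_mat Q) * (A * Q)"
      unfolding QAQ[symmetric] using Q A T
      by (simp add: assoc_mult_mat[of _ n n _ n _ n])
    then show ?thesis unfolding QQ' using left_mult_one_mat[OF mult_carrier_mat[OF A Q]] by simp
  qed
  define q where "q = col Q"
  have q: "q i \<in> carrier_vec n" if "i < n" for i using that Q by (simp add: q_def)
  have qx: "(transpose_mat Q *\<^sub>v x) $ i = q i \<bullet> x" if "i < n" for i x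
    using that Q by (simp add: q_def)
  have unit: "q i \<bullet> q i = 1" if "i < n" for i
    using arg_cong[OF QQ, of "\<lambda>M. M $$ (i, i)"] that Q by (simp add: q_def)
  have eig: "A *\<^sub>v q i = s i \<cdot>\<^sub>v q i" if i: "i < n" for i
  proof (rule eq_vecI)
    fix j assume "j < dim_vec (s i \<cdot>\<^sub>v q i)"
    then have j: "j < n" using carrier_vecD[OF q[OF i]] by simp
    have "(A *\<^sub>v q i) $ j = (A * Q) $$ (j, i)" using i j A Q by (simp add: q_def)
    also have "\<dots> = Q $$ (j, i) * s i"
      unfolding AQ using i j Q by (simp add: mat_diag_mult_right)
    finally show "(A *\<^sub>v q i) $ j = (s i \<cdot>\<^sub>v q i) $ j" using i j Q by (simp add: q_def)
  qed (use A carrier_vecD[OF q[OF i]] in auto)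
  have parseval: "x \<bullet> y = (\<Sum>i<n. (q i \<bullet> x) * (q i \<bullet> y))"
    if x: "x \<in> carrier_vec n" and y: "y \<in> carrier_vec n" for x y
  proof -
    have Ty: "transpose_mat Q *\<^sub>v y \<in> carrier_vec n" using T y by simp
    have "x \<bullet> y = x \<bullet> (Q *\<^sub>v (transpose_mat Q *\<^sub>v y))"
      using assoc_mult_mat_vec[OF Q T y] y by (simp add: QQ')
    also have "\<dots> = (transpose_mat Q *\<^sub>v x) \<bullet> (transpose_mat Q *\<^sub>v y)"
      using transpose_vec_mult_scalar[OF Q Ty x] by simp
    also have "\<dots> = (\<Sum>i<n. (q i \<bullet> x) * (q i \<bullet> y))"
      unfolding scalar_prod_def[of _ "transpose_mat Q *\<^sub>v y"] carrier_vecD[OF Ty]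
      by (intro sum.cong) (auto simp del: index_mult_mat_vec simp: qx)
    finally show ?thesis .
  qed
  have cp: "char_poly A = (\<Prod>a\<leftarrow>map s [0..<n]. [:- a, 1:])"
  proof -
    have "A = (A * Q) * transpose_mat Q"
      using A assoc_mult_mat[OF A Q T] by (simp add: QQ')
    then have "A = Q * mat_diag n s * transpose_mat Q" unfolding AQ .
    then have "similar_mat_wit A (mat_diag n s) Q (transpose_mat Q)"
      unfolding similar_mat_wit_def Let_def using A Q QQ QQ' by auto
    then have "char_poly A = char_poly (mat_diag n s)"
      using char_poly_similar similar_mat_def by blast
    also have "\<dots> = (\<Prod>a\<leftarrow>diag_mat (mat_diag n s). [:- a, 1:])"
      by (rule char_poly_upper_triangular[of _ n]) (auto simp: mat_diag_def)
    also have "diag_mat (mat_diag n s) = map s [0..<n]"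
      by (auto simp: diag_mat_def mat_diag_def)
    finally show ?thesis .
  qed
  show ?thesis unfolding eigenbasis_def
    using A sym q unit eig parseval cp by blast
qed

context
  fixes n :: nat and A :: "real mat" and q :: "nat \<Rightarrow> real vec" and s :: "nat \<Rightarrow> real"
  assumes eb: "eigenbasis n A q s"
begin

lemma eigenbasis_carrier: "A \<in> carrier_mat n n" and eigenbasis_symmetric: "transpose_mat A = A"
  and eigenbasis_vec: "i < n \<Longrightarrow> q i \<in> carrier_vec n"
  and eigenbasis_unit: "i < n \<Longrightarrow> q i \<bullet> q i = 1"
  and eigenbasis_eigen: "i < n \<Longrightarrow> A *\<^sub>v q i = s i \<cdot>\<^sub>v q i"
  and eigenbasis_parseval: "x \<in> carrier_vec n \<Longrightarrow> y \<in> carrier_vec n \<Longrightarrow>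
        x \<bullet> y = (\<Sum>i<n. (q i \<bullet> x) * (q i \<bullet> y))"
  and eigenbasis_char_poly: "char_poly A = (\<Prod>a\<leftarrow>map s [0..<n]. [:- a, 1:])"
  using eb unfolding eigenbasis_def by blast+

lemma eigenbasis_coord_mult:
  assumes "i < n" "y \<in> carrier_vec n"
  shows "q i \<bullet> (A *\<^sub>v y) = s i * (q i \<bullet> y)"
  using symmetric_scalar_prod[OF eigenbasis_carrier eigenbasis_symmetric eigenbasis_vec[OF assms(1)] assms(2)] eigenbasis_eigen[OF assms(1)]
    eigenbasis_vec[OF assms(1)] assms(2) by simp

lemma eigenbasis_coord_pow:
  assumes "i < n" "y \<in> carrier_vec n"
  shows "q i \<bullet> (A ^\<^sub>m k *\<^sub>v y) = s i ^ k * (q i \<bullet> y)"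
  using assms(2)
proof (induction k arbitrary: y)
  case 0
  then show ?case using eigenbasis_carrier by simp
next
  case (Suc k)
  have "A ^\<^sub>m Suc k *\<^sub>v y = A ^\<^sub>m k *\<^sub>v (A *\<^sub>v y)"
    using assoc_mult_mat_vec[OF pow_carrier_mat[OF eigenbasis_carrier] eigenbasis_carrier Suc.prems] by simp
  then show ?case
    using Suc.IH[of "A *\<^sub>v y"] eigenbasis_carrier Suc.prems
    by (simp add: eigenbasis_coord_mult[OF assms(1) Suc.prems])
qed

text \<open>These are the moments of the measure with mass \<open>(q i \<bullet> x)\<^sup>2\<close>
  at the point \<open>s i\<close>.\<close>

lemma eigenbasis_moment:
  assumes "x \<in> carrier_vec n"
  shows "x \<bullet> (A ^\<^sub>m k *\<^sub>v x) = (\<Sum>i<n. s i ^ k * (q i \<bullet> x)\<^sup>2)"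
proof -
  have "A ^\<^sub>m k *\<^sub>v x \<in> carrier_vec n" using assms pow_carrier_mat[OF eigenbasis_carrier, of k] by simp
  from eigenbasis_parseval[OF assms this] show ?thesis
    using eigenbasis_coord_pow[OF _ assms]
    by (simp add: power2_eq_square mult.left_commute mult.commute)
qed

lemma eigenbasis_eq_0:
  assumes "x \<in> carrier_vec n" "\<And>i. i < n \<Longrightarrow> q i \<bullet> x = 0"
  shows "x = 0\<^sub>v n"
  using eigenbasis_parseval[OF assms(1) assms(1)] assms scalar_prod_self_pos[OF assms(1)] by force

lemma eigenbasis_quadratic_form_le:
  assumes x: "x \<in> carrier_vec n" and s: "\<And>i. i < n \<Longrightarrow> \<bar>s i\<bar> \<le> D"
  shows "\<bar>x \<bullet> (A *\<^sub>v x)\<bar> \<le> D * (x \<bullet> x)"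
proof -
  have Ax: "A *\<^sub>v x \<in> carrier_vec n" using eigenbasis_carrier x by simp
  have "x \<bullet> (A *\<^sub>v x) = (\<Sum>i<n. s i * (q i \<bullet> x)\<^sup>2)"
    using eigenbasis_parseval[OF x Ax] eigenbasis_coord_mult[OF _ x]
    by (simp add: power2_eq_square mult.left_commute mult.commute)
  also have "\<bar>\<dots>\<bar> \<le> (\<Sum>i<n. D * (q i \<bullet> x)\<^sup>2)"
    by (rule order_trans[OF sum_abs]) (auto intro!: sum_mono mult_right_mono s simp: abs_mult)
  also have "\<dots> = D * (x \<bullet> x)"
    using eigenbasis_parseval[OF x x] by (simp add: power2_eq_square sum_distrib_left)
  finally show ?thesis .
qed

text \<open>The columns of \<open>A\<close> are the images of the unit vectors. Parseval writes
  their squared lengths as sums of squared eigenvalues, and exchanging the sums collects the weights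
  |q_i|^2 = 1.\<close>

lemma eigenbasis_frob_norm: "(frob_norm A)\<^sup>2 = (\<Sum>i<n. (s i)\<^sup>2)"
proof -
  note A = eigenbasis_carrier
  have dims: "dim_row A = n" "dim_col A = n" using A by auto
  have Au: "A *\<^sub>v unit_vec n j \<in> carrier_vec n" for j using A by simp
  have Aij: "(A *\<^sub>v unit_vec n j) $ i = A $$ (i, j)" if "i < n" "j < n" for i j
    using A that by simp
  have "(frob_norm A)\<^sup>2 = (\<Sum>i<n. \<Sum>j<n. (A $$ (i, j))\<^sup>2)"
    unfolding frob_norm_def dims by (simp add: sum_nonneg)
  also have "\<dots> = (\<Sum>j<n. \<Sum>i<n. (A $$ (i, j))\<^sup>2)" by (rule sum.swap)
  also have "\<dots> = (\<Sum>j<n. (A *\<^sub>v unit_vec n j) \<bullet> (A *\<^sub>v unit_vec n j))"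
    using dims by (intro sum.cong)
      (auto simp: scalar_prod_def[of _ "A *\<^sub>v _"] Aij power2_eq_square atLeast0LessThan)
  also have "\<dots> = (\<Sum>j<n. \<Sum>i<n. (s i)\<^sup>2 * (q i $ j)\<^sup>2)"
  proof (rule sum.cong[OF refl])
    fix j assume "j \<in> {..<n}"
    then show "(A *\<^sub>v unit_vec n j) \<bullet> (A *\<^sub>v unit_vec n j) = (\<Sum>i<n. (s i)\<^sup>2 * (q i $ j)\<^sup>2)"
      unfolding eigenbasis_parseval[OF Au Au] using eigenbasis_vec
      by (intro sum.cong) (auto simp: eigenbasis_coord_mult power2_eq_square)
  qed
  also have "\<dots> = (\<Sum>i<n. \<Sum>j<n. (s i)\<^sup>2 * (q i $ j)\<^sup>2)" by (rule sum.swap)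
  also have "\<dots> = (\<Sum>i<n. (s i)\<^sup>2 * (q i \<bullet> q i))"
    using carrier_vecD[OF eigenbasis_vec] by (intro sum.cong)
      (auto simp: scalar_prod_def power2_eq_square sum_distrib_left atLeast0LessThan)
  finally show ?thesis using eigenbasis_unit by simp
qed

end

text \<open>Each eigenvalue is the squared length of \<open>B *\<^sub>v q i\<close>.\<close>

lemma eigenbasis_gram_nonneg:
  assumes "eigenbasis n (transpose_mat B * B) q s" "B \<in> carrier_mat r n" "i < n"
  shows "s i \<ge> 0"
proof -
  note q = eigenbasis_vec[OF assms(1,3)]
  have "s i = q i \<bullet> ((transpose_mat B * B) *\<^sub>v q i)"
    using eigenbasis_coord_mult[OF assms(1,3) q] eigenbasis_unit[OF assms(1,3)] by simp
  also have "\<dots> = q i \<bullet> (transpose_mat B *\<^sub>v (B *\<^sub>v q i))"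
    using assms(2) q by (subst assoc_mult_mat_vec[of _ n r _ n]) auto
  also have "\<dots> = (B *\<^sub>v q i) \<bullet> (B *\<^sub>v q i)"
    using transpose_vec_mult_scalar[of "transpose_mat B" n r "B *\<^sub>v q i" "q i"] assms(2) q by simp
  finally show ?thesis using scalar_prod_self_ge_0 by simp
qed

text \<open>Right side minus left side is a sum with factors s_i^k (s_i - D)^2, nonnegative because
  the eigenvalues of a Gram matrix are. A free \<open>D\<close> expresses log-convexity without
  quotients; \<open>D = 1\<close> is plain convexity.\<close>

lemma gram_moment_convex:
  fixes B :: "real mat"
  assumes B: "B \<in> carrier_mat r n" and x: "x \<in> carrier_vec n"
  defines "m \<equiv> \<lambda>k. x \<bullet> ((transpose_mat B * B) ^\<^sub>m k *\<^sub>v x)"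
  shows "2 * D * m (Suc k) \<le> m (Suc (Suc k)) + D\<^sup>2 * m k"
proof -
  let ?A = "transpose_mat B * B"
  have "?A \<in> carrier_mat n n" "transpose_mat ?A = ?A"
    using B by (auto simp: transpose_mult[of _ n r])
  then obtain q s where eb: "eigenbasis n ?A q s" using eigenbasis_exists by blast
  have "m (Suc (Suc k)) + D\<^sup>2 * m k - 2 * D * m (Suc k)
      = (\<Sum>i<n. s i ^ k * (s i - D)\<^sup>2 * (q i \<bullet> x)\<^sup>2)"
    unfolding m_def eigenbasis_moment[OF eb x] sum_distrib_left
      sum.distrib[symmetric] sum_subtractf[symmetric]
    by (rule sum.cong) (auto simp: power2_eq_square algebra_simps)
  also have "\<dots> \<ge> 0"
    using eigenbasis_gram_nonneg[OF eb B] by (intro sum_nonneg) auto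
  finally show ?thesis by simp
qed

section \<open>Vectors orthogonal to a short list, and multiplicities of singular values\<close>

text \<open>Padding the list with zero vectors to length \<open>d\<close> yields a square matrix
  whose last row is zero, hence a singular one. A nonzero kernel vector is orthogonal to the whole
  list.\<close>

lemma exists_orthogonal_vec:
  fixes fs :: "real vec list"
  assumes fs: "set fs \<subseteq> carrier_vec d" and len: "length fs < d"
  shows "\<exists>y \<in> carrier_vec d. y \<noteq> 0\<^sub>v d \<and> (\<forall>f \<in> set fs. f \<bullet> y = 0)"
proof -
  define gs where "gs = fs @ replicate (d - length fs) (0\<^sub>v d)"
  have lg: "length gs = d" using len by (simp add: gs_def)
  have gs: "gs ! i \<in> carrier_vec d" if "i < d" for i
    using that fs lg by (auto simp: gs_def nth_append)
  define M where "M = mat_of_rows d gs"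
  have M: "M \<in> carrier_mat d d" using lg by (auto simp: M_def)
  have row: "row M i = gs ! i" if "i < d" for i
    using that gs lg by (simp add: M_def)
  have "\<not> d - 1 < length fs" using len by linarith
  then have last: "gs ! (d - 1) = 0\<^sub>v d" using len by (simp add: gs_def nth_append)
  have "transpose_mat M *\<^sub>v unit_vec d (d - 1) = 0\<^sub>v d"
    using M len row[of "d - 1"] last arg_cong[of "row M (d - 1)" "0\<^sub>v d"]
    by (intro eq_vecI) (auto simp: row_def vec_eq_iff)
  moreover have "unit_vec d (d - 1) \<noteq> (0\<^sub>v d :: real vec)"
    using len by (auto simp: vec_eq_iff intro!: exI[of _ "d - 1"])
  ultimately have "det (transpose_mat M) = 0"
    using det_0_iff_vec_prod_zero_field[of "transpose_mat M" d] M unit_vec_carrier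
    by (metis transpose_carrier_mat)
  then have "det M = 0" using det_transpose[OF M] by simp
  then obtain y where y: "y \<in> carrier_vec d" "y \<noteq> 0\<^sub>v d" "M *\<^sub>v y = 0\<^sub>v d"
    using det_0_iff_vec_prod_zero_field[OF M] by blast
  have "f \<bullet> y = 0" if f: "f \<in> set fs" for f
  proof -
    obtain i where i: "i < length fs" "f = fs ! i" using f by (auto simp: in_set_conv_nth)
    then have "f = row M i" using row[of i] len by (simp add: gs_def nth_append)
    then have "f \<bullet> y = (M *\<^sub>v y) $ i" using i len M by simp
    then show ?thesis using y(3) i len by simp
  qed
  then show ?thesis using y by blast
qed

lemma proots_prod_linear_factors:
  "proots (\<Prod>a\<leftarrow>xs. [:- a, 1:]) = mset (xs :: real list)"
proof (induction xs)
  case (Cons a xs)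
  have "(\<Prod>a\<leftarrow>xs. [:- a, 1:]) \<noteq> 0" by (auto simp: prod_list_zero_iff)
  then show ?case using Cons by (simp add: proots_mult del: mult_pCons_left)
qed simp

text \<open>The list behind \<open>sigma\<close> holds the same multiset of eigenvalues of the Gram
  matrix as \<open>s\<close>, so the two can be compared by multiplicity although their orders
  differ. Positions are shifted because \<open>sigma\<close> counts from 1.\<close>

lemma card_sigma_le_card_eigenvalue:
  fixes B :: "real mat"
  assumes eb: "eigenbasis n (transpose_mat B * B) q s" and \<epsilon>: "\<epsilon> > 0"
    and A: "A \<subseteq> {1..n}" "\<forall>i\<in>A. sigma i B = \<epsilon>"
  shows "card A \<le> card {j. j < n \<and> s j = \<epsilon>\<^sup>2}"
proof -
  define ls where "ls = rev (sorted_list_of_multiset (proots (char_poly (transpose_mat B * B))))"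
  have "proots (char_poly (transpose_mat B * B)) = mset (map s [0..<n])"
    unfolding eigenbasis_char_poly[OF eb] by (rule proots_prod_linear_factors)
  then have ms: "mset ls = mset (map s [0..<n])" by (simp add: ls_def)
  then have len: "length ls = n" using mset_eq_length by fastforce
  have sub: "(\<lambda>i. i - 1) ` A \<subseteq> {j. j < n \<and> ls ! j = \<epsilon>\<^sup>2}"
  proof (rule image_subsetI)
    fix i assume i: "i \<in> A"
    then have i': "i - 1 < n" using A(1) by fastforce
    have "sqrt (ls ! (i - 1)) = \<epsilon>"
      using A(2) i i' len by (auto simp: sigma_def singular_values_def ls_def[symmetric])
    \<comment> \<open>The real \<open>sqrt\<close> is negative on negative numbers, so positivity of
      \<epsilon> excludes a negative entry before squaring.\<close>
    then have "ls ! (i - 1) = \<epsilon>\<^sup>2" using \<epsilon> by (metis order_less_imp_le real_sqrt_gt_0_iff real_sqrt_pow2)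
    then show "i - 1 \<in> {j. j < n \<and> ls ! j = \<epsilon>\<^sup>2}" using i' by simp
  qed
  have "inj_on (\<lambda>i. i - 1) A" using A(1) by (intro inj_onI) (metis atLeastAtMost_iff eq_diff_iff subsetD)
  then have "card A = card ((\<lambda>i. i - 1) ` A)" by (simp add: card_image)
  also have "\<dots> \<le> card {j. j < n \<and> ls ! j = \<epsilon>\<^sup>2}" by (rule card_mono[OF _ sub]) simp
  also have "\<dots> = length (filter (\<lambda>x. x = \<epsilon>\<^sup>2) ls)"
    by (simp add: length_filter_conv_card len)
  also have "\<dots> = size (filter_mset (\<lambda>x. x = \<epsilon>\<^sup>2) (mset ls))" by (simp flip: mset_filter)
  also have "\<dots> = length (filter (\<lambda>x. x = \<epsilon>\<^sup>2) (map s [0..<n]))"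
    unfolding ms by (simp only: mset_filter[symmetric] size_mset)
  also have "\<dots> = card {j. j < n \<and> s j = \<epsilon>\<^sup>2}"
    unfolding length_filter_conv_card by (rule arg_cong[of _ _ card]) auto
  finally show ?thesis .
qed

section \<open>Powers of matrices and Gram products\<close>

lemma pow_mat_add:
  assumes "(A :: 'a :: semiring_1 mat) \<in> carrier_mat n n"
  shows "A ^\<^sub>m (i + j) = A ^\<^sub>m i * A ^\<^sub>m j"
proof (induction j)
  case 0
  then show ?case using assms pow_carrier_mat[OF assms, of i] by simp
next
  case (Suc j)
  then show ?case
    using assms assoc_mult_mat[OF pow_carrier_mat[OF assms, of i] pow_carrier_mat[OF assms, of j] assms]
    by simp
qed

lemma intertwine_pow_mat:
  assumes "(A :: 'a :: semiring_1 mat) \<in> carrier_mat n n" "C \<in> carrier_mat r r" "B \<in> carrier_mat r n"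
    and "B * A = C * B"
  shows "B * A ^\<^sub>m k = C ^\<^sub>m k * B"
proof (induction k)
  case 0
  then show ?case using assms by simp
next
  case (Suc k)
  note A = assms(1) and C = assms(2) and B = assms(3)
  note Ak = pow_carrier_mat[OF A, of k] and Ck = pow_carrier_mat[OF C, of k]
  have "B * A ^\<^sub>m Suc k = (B * A ^\<^sub>m k) * A" using assoc_mult_mat[OF B Ak A] by simp
  also have "\<dots> = C ^\<^sub>m k * (B * A)" unfolding Suc using assoc_mult_mat[OF Ck B A] by simp
  also have "\<dots> = C ^\<^sub>m Suc k * B" unfolding assms(4) using assoc_mult_mat[OF Ck C B] by simp
  finally show ?case .
qed

lemma scalar_prod_gram:
  fixes B :: "real mat"
  assumes "B \<in> carrier_mat r n" "x \<in> carrier_vec n" "y \<in> carrier_vec n"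
  shows "(B *\<^sub>v x) \<bullet> (B *\<^sub>v y) = x \<bullet> ((transpose_mat B * B) *\<^sub>v y)"
proof -
  have "x \<bullet> ((transpose_mat B * B) *\<^sub>v y) = x \<bullet> (transpose_mat B *\<^sub>v (B *\<^sub>v y))"
    using assms by (subst assoc_mult_mat_vec[of _ n r _ n]) auto
  also have "\<dots> = (B *\<^sub>v x) \<bullet> (B *\<^sub>v y)"
    using transpose_vec_mult_scalar[of "transpose_mat B" n r "B *\<^sub>v y" x] assms by simp
  finally show ?thesis by simp
qed

section \<open>Convex and log-convex sequences\<close>

text \<open>For the rescaled sequence \<open>m k / D ^ k\<close> the hypothesis is plain convexity,
  so a step that does not increase at \<open>N\<close> is preceded only by such steps. The downward
  induction shows this without dividing by a moment.\<close>

lemma moment_ratio_descends: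
  fixes m :: "nat \<Rightarrow> real"
  assumes convex: "\<And>k. 2 * D * m (Suc k) \<le> m (Suc (Suc k)) + D\<^sup>2 * m k"
    and D: "D > 0" and "m (Suc N) \<le> D * m N" and "k \<le> N"
  shows "m (Suc k) \<le> D * m k"
  using assms(4,3)
proof (induction rule: inc_induct)
  case (step k)
  then have "m (Suc (Suc k)) \<le> D * m (Suc k)" by simp
  with convex[of k] have "D * m (Suc k) \<le> D * (D * m k)"
    by (simp add: power2_eq_square algebra_simps)
  then show ?case using D by simp
qed simp

text \<open>Increments of a convex sequence are nondecreasing. A decrease from \<open>k\<close> to
  \<open>Suc k\<close> would therefore make all earlier steps decrease as well and put
  \<open>m N\<close> strictly below \<open>m 0\<close>.\<close>

lemma convex_sequence_mono_after:
  fixes m :: "nat \<Rightarrow> real"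
  assumes convex: "\<And>k. 2 * m (Suc k) \<le> m (Suc (Suc k)) + m k"
    and "m 0 \<le> m N" "0 < N" "N \<le> Suc k"
  shows "m k \<le> m (Suc k)"
proof (rule ccontr)
  assume neg: "\<not> ?thesis"
  have incr: "m (Suc i) - m i \<le> m (Suc j) - m j" if "i \<le> j" for i j
    using that by (rule lift_Suc_mono_le[of "\<lambda>i. m (Suc i) - m i", rotated]) (use convex in \<open>simp add: field_simps\<close>)
  have "m j < m 0" if "0 < j" "j \<le> Suc k" for j
    using that
  proof (induction j)
    case (Suc j)
    then have "m (Suc j) < m j" using incr[of j k] neg by simp
    then show ?case using Suc by (cases "j = 0") auto
  qed simp
  then show False using assms(2-4) by (meson not_le)
qed

lemma convex_sequence_ge_initial:
  fixes m :: "nat \<Rightarrow> real"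
  assumes convex: "\<And>k. 2 * m (Suc k) \<le> m (Suc (Suc k)) + m k" and "m 0 \<le> m 1"
  shows "m 0 \<le> m k"
proof (induction k)
  case (Suc k)
  then show ?case
    using convex_sequence_mono_after[of m 1 k, OF convex assms(2)] by simp
qed simp

subsection \<open>Balanced linear networks\<close>

text \<open>The hypotheses in the form that the argument uses: \<open>end_gram\<close> is what
  global optimality and orthogonal inputs say about the end-to-end map, and \<open>eps_small\<close>
  is the third bound on \<epsilon>, squared.\<close>

locale balanced_network =
  fixes d K L n :: nat and W :: "nat \<Rightarrow> real mat" and \<epsilon> :: real
  assumes d_eq: "d = n * K" and d_gt: "d > 2 * K" and L2: "L \<ge> 2"
    and hidden: "\<And>l. 1 \<le> l \<Longrightarrow> l \<le> L - 1 \<Longrightarrow> W l \<in> carrier_mat d d"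
    and last: "W L \<in> carrier_mat K d"
    and eps_pos: "\<epsilon> > 0"
    and eps_small: "2 * (sqrt (real K) + 1) * \<epsilon>\<^sup>2 \<le> 1"
    and balanced: "\<And>l. 1 \<le> l \<Longrightarrow> l \<le> L - 2 \<Longrightarrow>
        transpose_mat (W (l + 1)) * W (l + 1) = W l * transpose_mat (W l)"
    and balanced_last: "frob_norm (transpose_mat (W L) * W L - W (L - 1) * transpose_mat (W (L - 1)))
        \<le> \<epsilon>\<^sup>2 * sqrt (real d - real K)"
    and spectrum: "\<exists>A \<subseteq> {1..d}. card A = d - 2 * K \<and> (\<forall>i\<in>A. sigma i (W (L - 1)) = \<epsilon>)"
    and end_gram: "Wprod d W L * transpose_mat (Wprod d W L) = real n \<cdot>\<^sub>m 1\<^sub>m K"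
begin

abbreviation Z :: "nat \<Rightarrow> real mat" where "Z l \<equiv> Wprod d W l"

definition G :: "real mat" where "G = transpose_mat (W 1) * W 1"
definition H :: "real mat" where "H = W (L - 1) * transpose_mat (W (L - 1))"
definition E :: "real mat" where "E = transpose_mat (W L) * W L - H"
definition rate :: real where "rate = sqrt (2 * real K) * \<epsilon>\<^sup>2"

text \<open>Integrality improves n > 2 to n \<ge> 3. This gives room for the 3 K exceptional
  eigenvalues of \<open>E\<close>, and later for the comparison of the first two moments of
  \<open>H\<close>.\<close>

lemma K_pos: "K > 0" and n_ge_3: "n \<ge> 3" and d_ge: "3 * K \<le> d"
proof -
  show K: "K > 0" using d_gt d_eq by (cases K) auto
  have "2 * K < n * K" using d_gt d_eq by simp
  then show n: "n \<ge> 3" using K by simp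
  then show "3 * K \<le> d" unfolding d_eq by simp
qed

lemma pred_hidden: "W (L - 1) \<in> carrier_mat d d" and first_hidden: "W 1 \<in> carrier_mat d d"
  using hidden L2 by auto

lemma G_carrier: "G \<in> carrier_mat d d" and H_carrier: "H \<in> carrier_mat d d"
  and E_carrier: "E \<in> carrier_mat d d"
  using pred_hidden first_hidden last by (auto simp: G_def H_def E_def)

lemma E_sym: "transpose_mat E = E"
proof -
  have "transpose_mat H = H"
    using pred_hidden by (simp add: H_def transpose_mult[of _ d d])
  moreover have "transpose_mat (transpose_mat (W L) * W L) = transpose_mat (W L) * W L"
    using last by (simp add: transpose_mult[of _ d K])
  ultimately show ?thesis
    unfolding E_def using last H_carrier by (subst transpose_minus[of _ d d]) auto
qed

lemma rate_pos: "rate > 0" and rate_le: "rate \<le> 2 * (sqrt (real K) + 1) * \<epsilon>\<^sup>2"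
  and rate_le_1: "rate \<le> 1" and eps_sq_le_rate: "\<epsilon>\<^sup>2 \<le> rate"
proof -
  have K1: "real K \<ge> 1" using K_pos by simp
  show "rate > 0" using K1 eps_pos by (simp add: rate_def)
  have "sqrt (2 * real K) \<le> sqrt (4 * real K)" by simp
  also have "\<dots> = 2 * sqrt (real K)" by (simp add: real_sqrt_mult)
  finally have "sqrt (2 * real K) \<le> 2 * (sqrt (real K) + 1)" by simp
  then show "rate \<le> 2 * (sqrt (real K) + 1) * \<epsilon>\<^sup>2"
    unfolding rate_def by (rule mult_right_mono) simp
  then show "rate \<le> 1" using eps_small by simp
  have "sqrt (2 * real K) \<ge> 1" using K1 by simp
  then show "\<epsilon>\<^sup>2 \<le> rate"
    unfolding rate_def using mult_right_mono[of 1 "sqrt (2 * real K)" "\<epsilon>\<^sup>2"] by simp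
qed

section \<open>Products of balanced weights\<close>

lemma Z_carrier: "l \<le> L - 1 \<Longrightarrow> Z l \<in> carrier_mat d d"
proof (induction l)
  case (Suc l)
  then show ?case using hidden[of "Suc l"] by simp
qed simp

lemma Z_last: "Z L = W L * Z (L - 1)"
  using L2 by (cases L) auto

text \<open>Balancedness turns the Gram matrix of the next layer into the outer product of the
  current one, from which \<open>W (l + 1)\<close> can be pulled out on the left. Thus the Gram
  matrix of every layer acts after \<open>Z l\<close> as \<open>G\<close> acts before it.\<close>

lemma layer_intertwine: "l \<le> L - 2 \<Longrightarrow> transpose_mat (W (l + 1)) * W (l + 1) * Z l = Z l * G"
proof (induction l)
  case 0
  then show ?case
    using left_mult_one_mat[OF G_carrier] right_mult_one_mat[OF G_carrier] unfolding G_def by simp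
next
  case (Suc l)
  have W: "W (l + 1) \<in> carrier_mat d d" and Zl: "Z l \<in> carrier_mat d d"
    using hidden[of "l + 1"] Z_carrier[of l] Suc.prems by auto
  have bal: "transpose_mat (W (Suc l + 1)) * W (Suc l + 1) = W (l + 1) * transpose_mat (W (l + 1))"
    using balanced[of "l + 1"] Suc.prems by simp
  have "W (l + 1) * transpose_mat (W (l + 1)) * Z (Suc l)
      = W (l + 1) * (transpose_mat (W (l + 1)) * W (l + 1) * Z l)"
    using W Zl by (simp add: assoc_mult_mat[of _ d d _ d _ d])
  also have "\<dots> = Z (Suc l) * G"
    using Suc W Zl G_carrier by (simp add: assoc_mult_mat[of _ d d _ d _ d])
  finally show ?case unfolding bal .
qed

text \<open>The next case of \<open>layer_intertwine\<close> would involve \<open>W L\<close>, where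
  balancedness is only approximate; \<open>H\<close> takes the place of that Gram matrix.\<close>

lemma H_intertwine: "H * Z (L - 1) = Z (L - 1) * G"
proof -
  define l where "l = L - 2"
  have L1: "L - 1 = Suc l" using L2 by (simp add: l_def)
  have W: "W (Suc l) \<in> carrier_mat d d" and Zl: "Z l \<in> carrier_mat d d"
    using pred_hidden Z_carrier[of l] L1 by auto
  have "H * Z (L - 1) = W (Suc l) * (transpose_mat (W (l + 1)) * W (l + 1) * Z l)"
    unfolding H_def L1 using W Zl by (simp add: assoc_mult_mat[of _ d d _ d _ d])
  also have "\<dots> = Z (L - 1) * G"
    unfolding layer_intertwine[of l, unfolded l_def, OF order_refl, folded l_def] L1
    using W Zl G_carrier by (simp add: assoc_mult_mat[of _ d d _ d _ d])
  finally show ?thesis .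
qed

lemma Z_gram: "l \<le> L - 1 \<Longrightarrow> transpose_mat (Z l) * Z l = G ^\<^sub>m l"
proof (induction l)
  case 0
  then show ?case using G_carrier by simp
next
  case (Suc l)
  have W: "W (l + 1) \<in> carrier_mat d d" and Zl: "Z l \<in> carrier_mat d d"
    using hidden[of "l + 1"] Z_carrier[of l] Suc.prems by auto
  have "transpose_mat (Z (Suc l)) * Z (Suc l)
      = transpose_mat (Z l) * (transpose_mat (W (l + 1)) * W (l + 1) * Z l)"
    using W Zl by (simp add: assoc_mult_mat[of _ d d _ d _ d] transpose_mult[of _ d d])
  also have "\<dots> = transpose_mat (Z l) * (Z l * G)"
    using layer_intertwine[of l] Suc.prems by simp
  also have "\<dots> = G ^\<^sub>m Suc l"
    using Suc Zl G_carrier assoc_mult_mat[of "transpose_mat (Z l)" d d "Z l" d G d] by simp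
  finally show ?case .
qed

text \<open>The dual of \<open>Z_gram\<close> on the output side: with \<open>B\<close> the top
  factor, B (B^T B)^k B^T = (B B^T)^(k+1) absorbs one layer at a time.\<close>

lemma Z_outer: "l \<le> L - 2 \<Longrightarrow>
  Z (Suc l) * transpose_mat (Z (Suc l)) = (W (Suc l) * transpose_mat (W (Suc l))) ^\<^sub>m Suc l"
proof (induction l)
  case 0
  have "W (Suc 0) \<in> carrier_mat d d" using first_hidden by simp
  then show ?case by simp
next
  case (Suc l)
  define B where "B = W (Suc (Suc l))"
  have B: "B \<in> carrier_mat d d" and Zl: "Z (Suc l) \<in> carrier_mat d d"
    using hidden[of "Suc (Suc l)"] Z_carrier[of "Suc l"] Suc.prems by (auto simp: B_def)
  have T: "transpose_mat B \<in> carrier_mat d d" using B by simp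
  have TB: "transpose_mat B * B \<in> carrier_mat d d" and BT: "B * transpose_mat B \<in> carrier_mat d d"
    using B by auto
  note P = pow_carrier_mat[OF BT, of "Suc l"]
  have "Z (Suc (Suc l)) * transpose_mat (Z (Suc (Suc l)))
      = B * (Z (Suc l) * transpose_mat (Z (Suc l))) * transpose_mat B"
    using B Zl unfolding B_def
    by (simp add: assoc_mult_mat[of _ d d _ d _ d] transpose_mult[of _ d d] del: Wprod.simps)
       (simp add: assoc_mult_mat[of _ d d _ d _ d] transpose_mult[of _ d d])
  also have "Z (Suc l) * transpose_mat (Z (Suc l)) = (transpose_mat B * B) ^\<^sub>m Suc l"
    using Suc balanced[of "Suc l"] by (simp add: B_def)
  also have "B * (transpose_mat B * B) ^\<^sub>m Suc l = (B * transpose_mat B) ^\<^sub>m Suc l * B"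
    using B T assoc_mult_mat[OF B T B] by (intro intertwine_pow_mat[OF TB BT B]) simp
  also have "\<dots> * transpose_mat B = (B * transpose_mat B) ^\<^sub>m Suc (Suc l)"
    using assoc_mult_mat[OF P B T] by simp
  finally show ?case unfolding B_def .
qed

lemma Z_pred_outer: "Z (L - 1) * transpose_mat (Z (L - 1)) = H ^\<^sub>m (L - 1)"
  using Z_outer[of "L - 2"] L2 unfolding H_def by (simp add: numeral_2_eq_2 Suc_diff_Suc)

lemma norm_Z:
  assumes "l \<le> L - 1" "x \<in> carrier_vec d"
  shows "(Z l *\<^sub>v x) \<bullet> (Z l *\<^sub>v x) = x \<bullet> (G ^\<^sub>m l *\<^sub>v x)"
  using scalar_prod_gram[OF Z_carrier[OF assms(1)] assms(2,2)] Z_gram[OF assms(1)] by simp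


section \<open>Spectrum of the balancedness defect of the last layer\<close>

text \<open>Dimension count by contradiction: with more than 3 K other eigenvalues, fewer than
  \<open>d\<close> linear conditions on \<open>y\<close> would make \<open>x = B y\<close> an
  eigenvector of \<open>E\<close> for -\<epsilon>^2 that is orthogonal to all basis eigenvectors
  with that eigenvalue. The conditions are put on \<open>y\<close> because \<open>sigma\<close>
  describes the spectrum of B^T B, while \<open>H\<close> is B B^T.\<close>

lemma card_E_eigenvalues:
  assumes eb: "eigenbasis d E q e"
  shows "card {i. i < d \<and> e i \<noteq> - \<epsilon>\<^sup>2} \<le> 3 * K"
proof (rule ccontr)
  let ?I = "{i. i < d \<and> e i \<noteq> - \<epsilon>\<^sup>2}"
  assume many: "\<not> card ?I \<le> 3 * K"
  define B where "B = W (L - 1)"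
  have B: "B \<in> carrier_mat d d" using pred_hidden by (simp add: B_def)
  let ?BB = "transpose_mat B * B"
  have BB: "?BB \<in> carrier_mat d d" and "transpose_mat ?BB = ?BB"
    using B by (auto simp: transpose_mult[of _ d d])
  then obtain p s where ebB: "eigenbasis d ?BB p s" using eigenbasis_exists by blast
  let ?J = "{j. j < d \<and> s j = \<epsilon>\<^sup>2}"
  have J: "d - 2 * K \<le> card ?J"
    using spectrum card_sigma_le_card_eigenvalue[OF ebB eps_pos] unfolding B_def by metis
  have compl: "card {j. j < d \<and> \<not> P j} = d - card {j. j < d \<and> P j}" for P
  proof -
    have "{j. j < d \<and> \<not> P j} = {..<d} - {j. j < d \<and> P j}" by auto
    then show ?thesis by (simp add: card_Diff_subset subset_iff)
  qed
  have len: "length (filter P [0..<d]) = card {j. j < d \<and> P j}" for P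
    unfolding length_filter_conv_card by (rule arg_cong[of _ _ card]) auto
  define fs where "fs = map p (filter (\<lambda>j. \<not> s j = \<epsilon>\<^sup>2) [0..<d]) @ map (row (W L * B)) [0..<K]
     @ map (\<lambda>i. transpose_mat B *\<^sub>v q i) (filter (\<lambda>i. \<not> e i \<noteq> - \<epsilon>\<^sup>2) [0..<d])"
  have fs: "set fs \<subseteq> carrier_vec d"
    using eigenbasis_vec[OF ebB] eigenbasis_vec[OF eb] last B by (auto simp: fs_def)
  \<comment> \<open>At most 2 K conditions come from the eigenvectors of B^T B with eigenvalue other
    than \<epsilon>^2, K from the rows of \<open>W L * B\<close>, and fewer than d - 3 K from the
    eigenvectors of \<open>E\<close> for -\<epsilon>^2.\<close>
  have "length fs = (d - card ?J) + K + (d - card ?I)"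
    unfolding fs_def by (simp only: length_append length_map len compl) simp
  also have "\<dots> < d"
  proof -
    have "card ?I \<le> d" using card_mono[of "{..<d}" ?I] by (simp add: subset_iff)
    then show ?thesis using J many d_ge d_gt by linarith
  qed
  finally obtain y where y: "y \<in> carrier_vec d" "y \<noteq> 0\<^sub>v d" "\<forall>f \<in> set fs. f \<bullet> y = 0"
    using exists_orthogonal_vec[OF fs] by blast
  have y1: "p j \<bullet> y = 0" if "j < d" "s j \<noteq> \<epsilon>\<^sup>2" for j
    using y(3) that by (simp add: fs_def ball_Un)
  have y2: "row (W L * B) r \<bullet> y = 0" if "r < K" for r
    using y(3) that by (simp add: fs_def ball_Un)
  have y3: "(transpose_mat B *\<^sub>v q i) \<bullet> y = 0" if "i < d" "e i = - \<epsilon>\<^sup>2" for i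
    using y(3) that by (simp add: fs_def ball_Un)
  define x where "x = B *\<^sub>v y"
  have x: "x \<in> carrier_vec d" using B y by (simp add: x_def)
  have BBy: "?BB *\<^sub>v y \<in> carrier_vec d" using BB y by simp
  \<comment> \<open>All coordinates of \<open>y\<close> outside the \<epsilon>^2 eigenspace of B^T B
    vanish, so \<open>y\<close> lies in it; \<open>B\<close> then carries \<open>y\<close> to the
    \<epsilon>^2 eigenspace of \<open>H\<close>.\<close>
  have "?BB *\<^sub>v y - \<epsilon>\<^sup>2 \<cdot>\<^sub>v y = 0\<^sub>v d"
  proof (rule eigenbasis_eq_0[OF ebB])
    fix j assume j: "j < d"
    have "p j \<bullet> (?BB *\<^sub>v y - \<epsilon>\<^sup>2 \<cdot>\<^sub>v y) = (s j - \<epsilon>\<^sup>2) * (p j \<bullet> y)"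
      using eigenbasis_coord_mult[OF ebB j y(1)] eigenbasis_vec[OF ebB j] y(1) BBy
      by (simp add: scalar_prod_minus_distrib[of _ d] algebra_simps)
    then show "p j \<bullet> (?BB *\<^sub>v y - \<epsilon>\<^sup>2 \<cdot>\<^sub>v y) = 0" using y1[OF j] by auto
  qed (use BBy y in auto)
  then have BBy_eq: "?BB *\<^sub>v y = \<epsilon>\<^sup>2 \<cdot>\<^sub>v y"
    using BB y(1) by (auto simp: vec_eq_iff)
  have Hx: "H *\<^sub>v x = \<epsilon>\<^sup>2 \<cdot>\<^sub>v x"
  proof -
    have Bx: "transpose_mat B *\<^sub>v x = \<epsilon>\<^sup>2 \<cdot>\<^sub>v y"
      using BBy_eq B y(1) assoc_mult_mat_vec[of "transpose_mat B" d d B d y] by (simp add: x_def)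
    have "H *\<^sub>v x = B *\<^sub>v (transpose_mat B *\<^sub>v x)"
      unfolding H_def B_def[symmetric] using B x by (intro assoc_mult_mat_vec) auto
    then show ?thesis using Bx mult_mat_vec[OF B y(1)] by (simp add: x_def)
  qed
  have Wx: "W L *\<^sub>v x = 0\<^sub>v K"
  proof -
    have "W L *\<^sub>v x = (W L * B) *\<^sub>v y"
      unfolding x_def using last B y(1) by (intro assoc_mult_mat_vec[symmetric]) auto
    then show ?thesis using y2 last by (intro eq_vecI) auto
  qed
  have Ex: "E *\<^sub>v x = (- \<epsilon>\<^sup>2) \<cdot>\<^sub>v x"
  proof -
    have "E *\<^sub>v x = (transpose_mat (W L) * W L) *\<^sub>v x - H *\<^sub>v x"
      unfolding E_def using last H_carrier x by (intro minus_mult_distrib_mat_vec) auto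
    also have "(transpose_mat (W L) * W L) *\<^sub>v x = 0\<^sub>v d"
      using last x by (subst assoc_mult_mat_vec[of _ d K _ d]) (auto simp: Wx)
    finally show ?thesis using Hx x by (auto simp: vec_eq_iff)
  qed
  \<comment> \<open>Coordinates for the eigenvalue -\<epsilon>^2 vanish by the choice of
    \<open>y\<close>, the others because \<open>x\<close> satisfies the eigenvector equation for
    -\<epsilon>^2. This contradicts |x|^2 = \<epsilon>^2 |y|^2 > 0.\<close>
  have "x = 0\<^sub>v d"
  proof (rule eigenbasis_eq_0[OF eb x])
    fix i assume i: "i < d"
    show "q i \<bullet> x = 0"
    proof (cases "e i = - \<epsilon>\<^sup>2")
      case True
      have "(transpose_mat B *\<^sub>v q i) \<bullet> y = q i \<bullet> x"
        unfolding x_def using transpose_vec_mult_scalar[OF B y(1) eigenbasis_vec[OF eb i]] .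
      then show ?thesis using y3[OF i True] by simp
    next
      case False
      have "e i * (q i \<bullet> x) = (- \<epsilon>\<^sup>2) * (q i \<bullet> x)"
        using eigenbasis_coord_mult[OF eb i x] eigenbasis_vec[OF eb i] x unfolding Ex by simp
      then show ?thesis using False by (metis mult_cancel_right)
    qed
  qed
  moreover have "x \<bullet> x = \<epsilon>\<^sup>2 * (y \<bullet> y)"
    unfolding x_def scalar_prod_gram[OF B y(1) y(1)] BBy_eq using y(1) by simp
  ultimately show False
    using scalar_prod_self_pos[OF y(1,2)] eps_pos x by simp
qed

text \<open>The Frobenius bound allows (d - K) \<epsilon>^4 for the sum of the squared eigenvalues.
  At least d - 3 K of them use up \<epsilon>^4 each, so any other one must fit into the remaining 2
  K \<epsilon>^4, which is \<open>rate\<^sup>2\<close>.\<close>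

lemma E_eigenvalue_le:
  assumes eb: "eigenbasis d E q e" and i: "i < d"
  shows "\<bar>e i\<bar> \<le> rate"
proof (cases "e i = - \<epsilon>\<^sup>2")
  case True
  then show ?thesis using eps_sq_le_rate by simp
next
  case False
  let ?I = "{i. i < d \<and> e i \<noteq> - \<epsilon>\<^sup>2}"
  have I: "?I \<subseteq> {..<d}" "finite ?I" by auto
  have cI: "card ?I \<le> d" using card_mono[OF _ I(1)] by simp
  have eps4: "\<epsilon>\<^sup>2 * \<epsilon>\<^sup>2 \<ge> 0" by simp
  have "(\<Sum>i<d. (e i)\<^sup>2) = (\<Sum>i\<in>{..<d} - ?I. (e i)\<^sup>2) + (\<Sum>i\<in>?I. (e i)\<^sup>2)"
    by (rule sum.subset_diff[OF I(1)]) simp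
  also have "(\<Sum>i\<in>{..<d} - ?I. (e i)\<^sup>2) = (\<Sum>i\<in>{..<d} - ?I. \<epsilon>\<^sup>2 * \<epsilon>\<^sup>2)"
    by (rule sum.cong) (auto simp: power2_eq_square)
  also have "\<dots> = (real d - real (card ?I)) * (\<epsilon>\<^sup>2 * \<epsilon>\<^sup>2)"
    using I cI by (simp add: card_Diff_subset of_nat_diff)
  finally have sum_eq: "(\<Sum>i<d. (e i)\<^sup>2)
      = (real d - real (card ?I)) * (\<epsilon>\<^sup>2 * \<epsilon>\<^sup>2) + (\<Sum>i\<in>?I. (e i)\<^sup>2)" .
  have "(frob_norm E)\<^sup>2 \<le> (\<epsilon>\<^sup>2 * sqrt (real d - real K))\<^sup>2"
  proof (rule power_mono)
    show "frob_norm E \<le> \<epsilon>\<^sup>2 * sqrt (real d - real K)"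
      using balanced_last by (simp add: E_def H_def)
    show "0 \<le> frob_norm E" by (simp add: frob_norm_def sum_nonneg)
  qed
  also have "\<dots> = (\<epsilon>\<^sup>2 * \<epsilon>\<^sup>2) * (real d - real K)"
    using d_ge by (simp add: power_mult_distrib power2_eq_square)
  finally have "(\<Sum>i\<in>?I. (e i)\<^sup>2) \<le> (real (card ?I) - real K) * (\<epsilon>\<^sup>2 * \<epsilon>\<^sup>2)"
    unfolding eigenbasis_frob_norm[OF eb] sum_eq by (simp add: algebra_simps)
  also have "\<dots> \<le> (2 * real K) * (\<epsilon>\<^sup>2 * \<epsilon>\<^sup>2)"
    using card_E_eigenvalues[OF eb] by (intro mult_right_mono[OF _ eps4]) linarith
  also have "\<dots> = rate\<^sup>2" by (simp add: rate_def power_mult_distrib power2_eq_square)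
  finally have sum_le: "(\<Sum>i\<in>?I. (e i)\<^sup>2) \<le> rate\<^sup>2" .
  have "(e i)\<^sup>2 \<le> (\<Sum>i\<in>?I. (e i)\<^sup>2)" using False i by (intro member_le_sum) auto
  then have "(e i)\<^sup>2 \<le> rate\<^sup>2" using sum_le by simp
  then show ?thesis using rate_pos by (metis abs_le_square_iff abs_of_pos)
qed

lemma E_quadratic_form_le:
  assumes "y \<in> carrier_vec d"
  shows "\<bar>y \<bullet> (E *\<^sub>v y)\<bar> \<le> rate * (y \<bullet> y)"
proof -
  obtain q e where eb: "eigenbasis d E q e"
    using eigenbasis_exists[OF E_carrier E_sym] by blast
  show ?thesis by (rule eigenbasis_quadratic_form_le[OF eb assms E_eigenvalue_le[OF eb]])
qed

section \<open>Decay within classes and growth between classes\<close>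

lemma H_quadratic_form:
  assumes y: "y \<in> carrier_vec d"
  shows "y \<bullet> (H *\<^sub>v y) = (W L *\<^sub>v y) \<bullet> (W L *\<^sub>v y) - y \<bullet> (E *\<^sub>v y)"
proof -
  let ?S = "transpose_mat (W L) * W L"
  have S: "?S \<in> carrier_mat d d" using last by auto
  have c: "?S *\<^sub>v y \<in> carrier_vec d" "H *\<^sub>v y \<in> carrier_vec d" using S H_carrier y by auto
  have "E *\<^sub>v y = ?S *\<^sub>v y - H *\<^sub>v y"
    unfolding E_def using S H_carrier y by (intro minus_mult_distrib_mat_vec) auto
  then show ?thesis
    using c y by (simp add: scalar_prod_minus_distrib[of _ d] scalar_prod_gram[OF last y y])
qed

lemma within_class_decay:
  assumes x: "x \<in> carrier_vec d" and ker: "Z L *\<^sub>v x = 0\<^sub>v K" and l: "l \<le> L - 2"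
  shows "(Z (l + 1) *\<^sub>v x) \<bullet> (Z (l + 1) *\<^sub>v x) \<le> rate * ((Z l *\<^sub>v x) \<bullet> (Z l *\<^sub>v x))"
proof -
  define m where "m k = x \<bullet> (G ^\<^sub>m k *\<^sub>v x)" for k
  note M = Z_carrier[OF order_refl]
  define y where "y = Z (L - 1) *\<^sub>v x"
  have y: "y \<in> carrier_vec d" using M x by (simp add: y_def)
  have yy: "y \<bullet> y = m (L - 1)" unfolding y_def m_def by (rule norm_Z[OF order_refl x])
  have Wy: "W L *\<^sub>v y = 0\<^sub>v K"
    using assoc_mult_mat_vec[OF last M x] ker unfolding y_def Z_last by simp
  have Gx: "G *\<^sub>v x \<in> carrier_vec d" using G_carrier x by simp
  \<comment> \<open>The sequence \<open>m\<close> continues past layer L - 1 as moments of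
    \<open>G\<close>: its next value is the quadratic form of \<open>H\<close> at \<open>y\<close>,
    not the squared norm at the output layer, which is zero.\<close>
  have "y \<bullet> (H *\<^sub>v y) = y \<bullet> (Z (L - 1) *\<^sub>v (G *\<^sub>v x))"
    unfolding y_def assoc_mult_mat_vec[OF H_carrier M x, symmetric] H_intertwine
      assoc_mult_mat_vec[OF M G_carrier x] ..
  also have "\<dots> = x \<bullet> (G ^\<^sub>m (L - 1) *\<^sub>v (G *\<^sub>v x))"
    unfolding y_def scalar_prod_gram[OF M x Gx] Z_gram[OF order_refl] ..
  also have "\<dots> = m (Suc (L - 1))"
    unfolding m_def using assoc_mult_mat_vec[OF pow_carrier_mat[OF G_carrier] G_carrier x] by simp
  \<comment> \<open>As \<open>W L\<close> annihilates \<open>y\<close>, the form of \<open>H\<close>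
    at \<open>y\<close> is minus that of \<open>E\<close>, and the bound on \<open>E\<close> gives
    the ratio at the top, from where it descends.\<close>
  finally have top: "m (Suc (L - 1)) \<le> rate * m (L - 1)"
    using H_quadratic_form[OF y] E_quadratic_form_le[OF y] Wy yy by simp
  have "m (Suc l) \<le> rate * m l"
    by (rule moment_ratio_descends[OF _ rate_pos top])
      (use gram_moment_convex[OF first_hidden x, folded G_def] l in \<open>auto simp: m_def\<close>)
  then show ?thesis using norm_Z[of "l + 1" x] norm_Z[of l x] x l L2 by (simp add: m_def)
qed

text \<open>With \<open>w = W\<^sub>L\<^sup>T c\<close>, the squared norms at layer \<open>l\<close> are the moments of \<open>H\<close> of order
  \<open>l + L - 1\<close> at \<open>w\<close>, and a convex sequence whose value at \<open>L - 1\<close> is at least its initial value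
  increases from there on.\<close>

lemma between_class_nondecreasing:
  assumes c: "c \<in> carrier_vec K" and l: "l \<le> L - 2"
  shows "(Z l *\<^sub>v (transpose_mat (Z L) *\<^sub>v c)) \<bullet> (Z l *\<^sub>v (transpose_mat (Z L) *\<^sub>v c))
      \<le> (Z (l + 1) *\<^sub>v (transpose_mat (Z L) *\<^sub>v c)) \<bullet> (Z (l + 1) *\<^sub>v (transpose_mat (Z L) *\<^sub>v c))"
proof -
  define w where "w = transpose_mat (W L) *\<^sub>v c"
  have w: "w \<in> carrier_vec d" using last c by (simp add: w_def)
  note M = Z_carrier[OF order_refl]
  have MT: "transpose_mat (Z (L - 1)) \<in> carrier_mat d d" using M by simp
  define u where "u = transpose_mat (Z L) *\<^sub>v c"
  have ZL: "Z L \<in> carrier_mat K d" unfolding Z_last using last M by auto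
  have u: "u \<in> carrier_vec d" using ZL c by (simp add: u_def)
  have u_eq: "u = transpose_mat (Z (L - 1)) *\<^sub>v w"
    unfolding u_def w_def Z_last transpose_mult[OF last M]
    using last MT c by (intro assoc_mult_mat_vec) auto
  define m where "m k = w \<bullet> (H ^\<^sub>m k *\<^sub>v w)" for k
  \<comment> \<open>The Gram matrix of the transposed weight is \<open>H\<close>, and the parameter
    \<open>D\<close> is 1.\<close>
  have m_convex: "2 * m (Suc k) \<le> m (Suc (Suc k)) + m k" for k
    using gram_moment_convex[of "transpose_mat (W (L - 1))" d d w 1 k] pred_hidden w
    by (simp add: m_def H_def)
  \<comment> \<open>Each \<open>u\<close> is the transpose of \<open>Z (L - 1)\<close> applied to
    \<open>w\<close>. One transpose moves across the scalar product, the powers of \<open>G\<close>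
    pass through \<open>Z (L - 1)\<close> as powers of \<open>H\<close>, and the product with the
    other transpose contributes the order L - 1.\<close>
  have moment: "(Z l *\<^sub>v u) \<bullet> (Z l *\<^sub>v u) = m (l + (L - 1))" if l: "l \<le> L - 1" for l
  proof -
    note Gl = pow_carrier_mat[OF G_carrier, of l] and Hl = pow_carrier_mat[OF H_carrier, of l]
    have Mu: "Z (L - 1) *\<^sub>v u = H ^\<^sub>m (L - 1) *\<^sub>v w"
      unfolding u_eq using assoc_mult_mat_vec[OF M MT w] Z_pred_outer by simp
    have "(Z l *\<^sub>v u) \<bullet> (Z l *\<^sub>v u) = u \<bullet> (G ^\<^sub>m l *\<^sub>v u)" by (rule norm_Z[OF l u])
    also have "\<dots> = w \<bullet> (Z (L - 1) *\<^sub>v (G ^\<^sub>m l *\<^sub>v u))"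
      using transpose_vec_mult_scalar[OF M _ w, of "G ^\<^sub>m l *\<^sub>v u"] Gl u by (simp add: u_eq)
    also have "Z (L - 1) *\<^sub>v (G ^\<^sub>m l *\<^sub>v u) = (Z (L - 1) * G ^\<^sub>m l) *\<^sub>v u"
      using assoc_mult_mat_vec[OF M Gl u] by simp
    also have "\<dots> = H ^\<^sub>m l *\<^sub>v (H ^\<^sub>m (L - 1) *\<^sub>v w)"
      unfolding intertwine_pow_mat[OF G_carrier H_carrier M H_intertwine[symmetric]]
      using assoc_mult_mat_vec[OF Hl M u] Mu by simp
    also have "\<dots> = H ^\<^sub>m (l + (L - 1)) *\<^sub>v w"
      unfolding pow_mat_add[OF H_carrier]
      using assoc_mult_mat_vec[OF Hl pow_carrier_mat[OF H_carrier] w] by simp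
    finally show ?thesis by (simp add: m_def)
  qed
  have m0: "m 0 = w \<bullet> w" using w H_carrier by (simp add: m_def)
  have m1: "m 1 = w \<bullet> (H *\<^sub>v w)" using w H_carrier by (simp add: m_def)
  have mtop: "m (L - 1) = real n * (c \<bullet> c)"
  proof -
    have "m (L - 1) = u \<bullet> u" using moment[of 0] u by simp
    also have "\<dots> = c \<bullet> ((Z L * transpose_mat (Z L)) *\<^sub>v c)"
      unfolding u_def using scalar_prod_gram[of "transpose_mat (Z L)" d K c c] ZL c by simp
    also have "\<dots> = real n * (c \<bullet> c)"
    proof -
      have "(real n \<cdot>\<^sub>m 1\<^sub>m K) *\<^sub>v c = real n \<cdot>\<^sub>v c"
        using c by (intro eq_vecI) auto
      then show ?thesis unfolding end_gram using c by simp
    qed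
    finally show ?thesis .
  qed
  \<comment> \<open>This is \<open>m 0 \<le> m (L - 1)\<close>. If it failed, \<open>m 1\<close>
    would be at least \<open>m 0\<close>, and convexity would give the inequality after all.\<close>
  have bound: "w \<bullet> w \<le> real n * (c \<bullet> c)"
  proof (rule ccontr)
    assume contra: "\<not> ?thesis"
    define t where "t = w \<bullet> w"
    define z where "z = W L *\<^sub>v w"
    have z: "z \<in> carrier_vec K" using last w by (simp add: z_def)
    have t: "t \<ge> 0" unfolding t_def by (rule scalar_prod_self_ge_0)
    have cz: "c \<bullet> z = t"
      using transpose_vec_mult_scalar[OF last w c] by (simp add: z_def t_def w_def)
    \<comment> \<open>Expanding this square does the work of Cauchy-Schwarz: the scalar product of
      \<open>c\<close> and \<open>z\<close> is \<open>t\<close>, and n |c|^2 < t by assumption, so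
      |z|^2 \<ge> n t.\<close>
    have "0 \<le> (z - real n \<cdot>\<^sub>v c) \<bullet> (z - real n \<cdot>\<^sub>v c)" by (rule scalar_prod_self_ge_0)
    also have "\<dots> = z \<bullet> z - 2 * real n * t + real n * (real n * (c \<bullet> c))"
      using z c cz comm_scalar_prod[OF z c]
      by (simp add: scalar_prod_minus_distrib[of _ K] minus_scalar_prod_distrib[of _ K] algebra_simps)
    also have "\<dots> \<le> z \<bullet> z - 2 * real n * t + real n * t"
      using contra by (simp add: t_def mult_left_mono)
    finally have zz: "z \<bullet> z \<ge> real n * t" by (simp add: algebra_simps)
    have "w \<bullet> (H *\<^sub>v w) \<ge> z \<bullet> z - rate * t"
      using H_quadratic_form[OF w] E_quadratic_form_le[OF w] by (simp add: z_def t_def)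
    \<comment> \<open>With \<open>rate\<close> at most 1 and \<open>n\<close> at least 3 the form of
      \<open>H\<close> at \<open>w\<close> is at least 2 t, hence
      \<open>m 0 \<le> m 1\<close>.\<close>
    moreover have "rate * t \<le> 1 * t" using rate_le_1 t by (rule mult_right_mono)
    moreover have "3 * t \<le> real n * t" using n_ge_3 t by (intro mult_right_mono) auto
    ultimately have "m 0 \<le> m 1" using zz t unfolding m0 m1 t_def by simp
    then have "m 0 \<le> m (L - 1)" by (rule convex_sequence_ge_initial[of m, OF m_convex])
    then show False using contra mtop m0 by simp
  qed
  have "m (l + (L - 1)) \<le> m (Suc (l + (L - 1)))"
    by (rule convex_sequence_mono_after[of m "L - 1", OF m_convex])
      (use bound mtop m0 L2 in auto)
  then show ?thesis
    using moment[of l] moment[of "l + 1"] l L2 unfolding u_def by simp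
qed

end

subsection \<open>Covariance traces and labels\<close>

text \<open>Means are taken of the raw inputs: by linearity the feature means of every layer are
  images of these fixed vectors, so layers are compared at the same arguments.\<close>

definition input_mean :: "real mat \<Rightarrow> nat \<Rightarrow> nat \<Rightarrow> real vec" where
  "input_mean X n k = vec (dim_row X) (\<lambda>a. (1 / real n) * (\<Sum>i<n. X $$ (a, k * n + i)))"

definition input_global_mean :: "real mat \<Rightarrow> nat \<Rightarrow> nat \<Rightarrow> real vec" where
  "input_global_mean X K n = vec (dim_row X) (\<lambda>a. (1 / real K) * (\<Sum>k<K. input_mean X n k $ a))"

lemma class_index_less:
  assumes "k < K" "i < n"
  shows "k * n + i < n * (K :: nat)"
proof -
  have "k * n + i < Suc k * n" using assms(2) by simp
  also have "\<dots> \<le> K * n" using assms(1) by (intro mult_le_mono1) simp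
  finally show ?thesis by (simp add: mult.commute)
qed

lemma mult_mat_vec_average:
  fixes A :: "real mat"
  assumes "A \<in> carrier_mat r d" "a < r"
  shows "(A *\<^sub>v vec d (\<lambda>b. (\<Sum>i<m. f i b) / c)) $ a = (\<Sum>i<m. (A *\<^sub>v vec d (f i)) $ a) / c"
proof -
  have "(A *\<^sub>v vec d (\<lambda>b. (\<Sum>i<m. f i b) / c)) $ a = (\<Sum>b<d. \<Sum>i<m. A $$ (a, b) * f i b / c)"
    using assms by (simp add: scalar_prod_def atLeast0LessThan sum_distrib_left sum_divide_distrib)
  also have "\<dots> = (\<Sum>i<m. \<Sum>b<d. A $$ (a, b) * f i b / c)" by (rule sum.swap)
  also have "\<dots> = (\<Sum>i<m. (A *\<^sub>v vec d (f i)) $ a) / c"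
    using assms by (simp add: scalar_prod_def atLeast0LessThan sum_divide_distrib)
  finally show ?thesis .
qed

context
  fixes d K n l :: nat and W :: "nat \<Rightarrow> real mat" and X :: "real mat" and r :: nat
  assumes d: "d = n * K" and X: "X \<in> carrier_mat d d" and Z: "Wprod d W l \<in> carrier_mat r d"
begin

lemma class_mean_eq:
  assumes "k < K"
  shows "class_mean d W X n l k = Wprod d W l *\<^sub>v input_mean X n k"
proof (rule eq_vecI)
  fix a assume "a < dim_vec (Wprod d W l *\<^sub>v input_mean X n k)"
  then have a: "a < r" using Z by simp
  have "vec d (\<lambda>b. X $$ (b, k * n + i)) = col X (k * n + i)" for i
    using X by (auto simp: col_def)
  then show "class_mean d W X n l k $ a = (Wprod d W l *\<^sub>v input_mean X n k) $ a"
    using a Z X unfolding class_mean_def input_mean_def feat_def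
    by (simp add: mult_mat_vec_average[OF Z a] del: index_mult_mat_vec)
qed (simp add: class_mean_def)

lemma global_mean_eq: "global_mean d W X K n l = Wprod d W l *\<^sub>v input_global_mean X K n"
proof (rule eq_vecI)
  fix a assume "a < dim_vec (Wprod d W l *\<^sub>v input_global_mean X K n)"
  then have a: "a < r" using Z by simp
  have "vec d (\<lambda>b. input_mean X n k $ b) = input_mean X n k" for k
    using X by (intro eq_vecI) (auto simp: input_mean_def)
  then show "global_mean d W X K n l $ a = (Wprod d W l *\<^sub>v input_global_mean X K n) $ a"
    using a Z X unfolding global_mean_def input_global_mean_def
    by (simp add: mult_mat_vec_average[OF Z a] class_mean_eq del: index_mult_mat_vec)
qed (simp add: global_mean_def)

lemma input_mean_carrier: "input_mean X n k \<in> carrier_vec d"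
  and input_global_mean_carrier: "input_global_mean X K n \<in> carrier_vec d"
  using X by (auto simp: input_mean_def input_global_mean_def)

text \<open>The trace of an outer product v v^T is |v|^2, and linearity pulls the weights out of the
  deviation from the mean.\<close>

lemma mtrace_Sigma_W:
  "mtrace (Sigma_W d W X K n l) = (1 / real (n * K)) * (\<Sum>k<K. \<Sum>i<n.
     (Wprod d W l *\<^sub>v (col X (k * n + i) - input_mean X n k)) \<bullet>
     (Wprod d W l *\<^sub>v (col X (k * n + i) - input_mean X n k)))"
proof -
  let ?v = "\<lambda>k i. Wprod d W l *\<^sub>v (col X (k * n + i) - input_mean X n k)"
  have v: "?v k i $ a = feat d W X n l k i $ a - class_mean d W X n l k $ a"
    if "k < K" "i < n" "a < r" for k i a
  proof -
    have "col X (k * n + i) \<in> carrier_vec d" using X by auto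
    then show ?thesis
      unfolding feat_def class_mean_eq[OF that(1)]
      using mult_minus_distrib_mat_vec[OF Z _ input_mean_carrier] Z that by (simp del: index_mult_mat_vec)
  qed
  have "mtrace (Sigma_W d W X K n l) = (1 / real (n * K)) * (\<Sum>a<r. \<Sum>k<K. \<Sum>i<n. (?v k i $ a)\<^sup>2)"
    using Z v unfolding mtrace_def Sigma_W_def sum_distrib_left
    by (intro sum.cong) (auto simp: sum_distrib_left power2_eq_square intro!: sum.cong)
  also have "(\<Sum>a<r. \<Sum>k<K. \<Sum>i<n. (?v k i $ a)\<^sup>2) = (\<Sum>k<K. \<Sum>i<n. \<Sum>a<r. (?v k i $ a)\<^sup>2)"
    by (subst sum.swap, rule sum.cong[OF refl], rule sum.swap)
  also have "\<dots> = (\<Sum>k<K. \<Sum>i<n. ?v k i \<bullet> ?v k i)"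
    using Z by (intro sum.cong refl)
      (auto simp: scalar_prod_def[of _ "_ *\<^sub>v _"] power2_eq_square atLeast0LessThan)
  finally show ?thesis .
qed

lemma mtrace_Sigma_B:
  "mtrace (Sigma_B d W X K n l) = (1 / real K) * (\<Sum>k<K.
     (Wprod d W l *\<^sub>v (input_mean X n k - input_global_mean X K n)) \<bullet>
     (Wprod d W l *\<^sub>v (input_mean X n k - input_global_mean X K n)))"
proof -
  let ?v = "\<lambda>k. Wprod d W l *\<^sub>v (input_mean X n k - input_global_mean X K n)"
  have v: "?v k $ a = class_mean d W X n l k $ a - global_mean d W X K n l $ a"
    if "k < K" "a < r" for k a
    unfolding global_mean_eq class_mean_eq[OF that(1)]
    using mult_minus_distrib_mat_vec[OF Z input_mean_carrier input_global_mean_carrier] Z that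
    by (simp del: index_mult_mat_vec)
  have "mtrace (Sigma_B d W X K n l) = (1 / real K) * (\<Sum>a<r. \<Sum>k<K. (?v k $ a)\<^sup>2)"
    using Z v unfolding mtrace_def Sigma_B_def sum_distrib_left
    by (intro sum.cong) (auto simp: sum_distrib_left power2_eq_square intro!: sum.cong)
  also have "(\<Sum>a<r. \<Sum>k<K. (?v k $ a)\<^sup>2) = (\<Sum>k<K. \<Sum>a<r. (?v k $ a)\<^sup>2)"
    by (rule sum.swap)
  also have "\<dots> = (\<Sum>k<K. ?v k \<bullet> ?v k)"
    using Z by (intro sum.cong refl)
      (auto simp: scalar_prod_def[of _ "_ *\<^sub>v _"] power2_eq_square atLeast0LessThan)
  finally show ?thesis .
qed

end

section \<open>The label matrix and the end-to-end map\<close>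

text \<open>The indices \<open>j\<close> with \<open>j div n = k\<close> form the block of length
  \<open>n\<close> that starts at \<open>k * n\<close>.\<close>

lemma sum_class_indices:
  fixes f :: "nat \<Rightarrow> real"
  assumes "k < K"
  shows "(\<Sum>j<n * K. if k = j div n then f j else 0) = (\<Sum>i<n. f (k * n + i))"
proof -
  have "{j \<in> {..<n * K}. k = j div n} = (\<lambda>i. k * n + i) ` {..<n}" (is "?L = ?R")
  proof
    show "?L \<subseteq> ?R"
    proof
      fix j assume "j \<in> ?L"
      then have "j div n = k" "n > 0" by (auto intro: Nat.gr0I)
      then have "j = k * n + j mod n" "j mod n < n" using div_mult_mod_eq[of j n] by auto
      then show "j \<in> ?R" by blast
    qed
    show "?R \<subseteq> ?L" using class_index_less[OF assms] by auto
  qed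
  then have "(\<Sum>j<n * K. if k = j div n then f j else 0) = (\<Sum>j\<in>(\<lambda>i. k * n + i) ` {..<n}. f j)"
    by (simp add: sum.inter_filter[symmetric])
  also have "\<dots> = (\<Sum>i<n. f (k * n + i))" by (subst sum.reindex) (auto simp: inj_on_def)
  finally show ?thesis .
qed

text \<open>The rows are indicator vectors of disjoint blocks of \<open>n\<close> columns.\<close>

lemma label_mat_gram: "label_mat K n * transpose_mat (label_mat K n) = real n \<cdot>\<^sub>m 1\<^sub>m K"
proof (rule eq_matI)
  fix i j assume "i < dim_row (real n \<cdot>\<^sub>m 1\<^sub>m K)" "j < dim_col (real n \<cdot>\<^sub>m 1\<^sub>m K)"
  then have i: "i < K" and j: "j < K" by auto
  have "(label_mat K n * transpose_mat (label_mat K n)) $$ (i, j)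
      = (\<Sum>c<n * K. if i = c div n then (if j = c div n then 1 else 0) else 0)"
    using i j by (auto simp: label_mat_def scalar_prod_def atLeast0LessThan intro!: sum.cong)
  also have "\<dots> = (\<Sum>t<n. if j = (i * n + t) div n then 1 else 0)" by (rule sum_class_indices[OF i])
  also have "\<dots> = (\<Sum>t<n. if i = j then 1 else 0)" by (rule sum.cong) auto
  finally show "(label_mat K n * transpose_mat (label_mat K n)) $$ (i, j)
      = (real n \<cdot>\<^sub>m 1\<^sub>m K) $$ (i, j)" using i j by simp
qed (simp_all add: label_mat_def)

context
  fixes d K n :: nat and X F :: "real mat"
  assumes d: "d = n * K" and n: "n > 0" and X: "X \<in> carrier_mat d d"
    and orth: "transpose_mat X * X = 1\<^sub>m d"
    and F: "F \<in> carrier_mat K d" and FX: "F * X = label_mat K n"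
begin

lemma X_right_orth: "X * transpose_mat X = 1\<^sub>m d"
  using mat_mult_left_right_inverse[OF _ X orth] X by simp

lemma F_eq: "F = label_mat K n * transpose_mat X"
proof -
  have "label_mat K n * transpose_mat X = F * (X * transpose_mat X)"
    unfolding FX[symmetric] using F X by (intro assoc_mult_mat) auto
  then show ?thesis using X_right_orth F by simp
qed

lemma label_carrier: "label_mat K n \<in> carrier_mat K d"
  by (simp add: label_mat_def d)

lemma FT_eq: "transpose_mat F = X * transpose_mat (label_mat K n)"
  unfolding F_eq using transpose_mult[OF label_carrier, of "transpose_mat X" d] X by simp

text \<open>In (Y X^T)(X Y^T) the orthogonal \<open>X\<close> cancels, which leaves the Gram matrix
  of the labels. Applied to the end-to-end map this supplies \<open>end_gram\<close>.\<close>

lemma F_gram: "F * transpose_mat F = real n \<cdot>\<^sub>m 1\<^sub>m K"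
proof -
  note Y = label_carrier
  have YT: "transpose_mat (label_mat K n) \<in> carrier_mat d K"
    and XT: "transpose_mat X \<in> carrier_mat d d" using Y X by auto
  have "F * transpose_mat F = label_mat K n * transpose_mat X * (X * transpose_mat (label_mat K n))"
    unfolding FT_eq by (simp add: F_eq)
  also have "\<dots> = label_mat K n * (transpose_mat X * X * transpose_mat (label_mat K n))"
    using assoc_mult_mat[OF Y XT mult_carrier_mat[OF X YT]] assoc_mult_mat[OF XT X YT] by simp
  also have "\<dots> = label_mat K n * transpose_mat (label_mat K n)"
    unfolding orth using left_mult_one_mat[OF YT] by simp
  finally show ?thesis by (simp add: label_mat_gram)
qed

lemma F_col:
  assumes "k < K" "i < n"
  shows "F *\<^sub>v col X (k * n + i) = unit_vec K k"
proof -
  have j: "k * n + i < d" unfolding d by (rule class_index_less[OF assms])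
  have "F *\<^sub>v col X (k * n + i) = col (label_mat K n) (k * n + i)"
    unfolding FX[symmetric] using F X j by (intro eq_vecI) auto
  also have "\<dots> = unit_vec K k"
    using assms j by (intro eq_vecI) (auto simp: label_mat_def d)
  finally show ?thesis .
qed

lemma F_input_mean:
  assumes "k < K"
  shows "F *\<^sub>v input_mean X n k = unit_vec K k"
proof (rule eq_vecI)
  fix a assume "a < dim_vec (unit_vec K k :: real vec)"
  then have a: "a < K" by simp
  have "vec d (\<lambda>b. X $$ (b, k * n + i)) = col X (k * n + i)" for i
    using X by (auto simp: col_def)
  then show "(F *\<^sub>v input_mean X n k) $ a = unit_vec K k $ a"
    using a F X n F_col[OF assms] unfolding input_mean_def
    by (simp add: mult_mat_vec_average[OF F a] del: index_mult_mat_vec)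
qed (use F in simp)

text \<open>A sample and its class mean are mapped to the same label, so the deviation lies in the
  kernel, as \<open>within_class_decay\<close> requires.\<close>

lemma F_deviation:
  assumes "k < K" "i < n"
  shows "F *\<^sub>v (col X (k * n + i) - input_mean X n k) = 0\<^sub>v K"
proof -
  have "col X (k * n + i) \<in> carrier_vec d" "input_mean X n k \<in> carrier_vec d"
    using X by (auto simp: input_mean_def)
  from mult_minus_distrib_mat_vec[OF F this] show ?thesis
    unfolding F_col[OF assms] F_input_mean[OF assms(1)] by (simp add: minus_cancel_vec)
qed

text \<open>As F^T = X Y^T, column \<open>k\<close> of F^T is the sum of the inputs of class
  \<open>k\<close>.\<close>

lemma input_mean_eq_transpose:
  assumes k: "k < K"
  shows "input_mean X n k = transpose_mat F *\<^sub>v ((1 / real n) \<cdot>\<^sub>v unit_vec K k)"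
proof (rule eq_vecI)
  fix a assume "a < dim_vec (transpose_mat F *\<^sub>v ((1 / real n) \<cdot>\<^sub>v unit_vec K k))"
  then have a: "a < d" using F by simp
  have "(transpose_mat F *\<^sub>v ((1 / real n) \<cdot>\<^sub>v unit_vec K k)) $ a = (1 / real n) * transpose_mat F $$ (a, k)"
    using F a k by simp
  also have "transpose_mat F $$ (a, k) = (\<Sum>j<n * K. if k = j div n then X $$ (a, j) else 0)"
    unfolding FT_eq using X a k
    by (auto simp: label_mat_def scalar_prod_def atLeast0LessThan d intro!: sum.cong)
  also have "\<dots> = (\<Sum>i<n. X $$ (a, k * n + i))" by (rule sum_class_indices[OF k])
  finally show "input_mean X n k $ a
      = (transpose_mat F *\<^sub>v ((1 / real n) \<cdot>\<^sub>v unit_vec K k)) $ a"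
    using a X by (simp add: input_mean_def)
qed (use F X in \<open>simp add: input_mean_def\<close>)

text \<open>The coefficient vector is e_k / n minus its average over the classes. This is the form
  in which \<open>between_class_nondecreasing\<close> takes its argument.\<close>

lemma centred_mean_in_range:
  assumes k: "k < K"
  shows "\<exists>c \<in> carrier_vec K. input_mean X n k - input_global_mean X K n = transpose_mat F *\<^sub>v c"
proof -
  define e :: "nat \<Rightarrow> real vec" where "e k = (1 / real n) \<cdot>\<^sub>v unit_vec K k" for k
  define g where "g = vec K (\<lambda>b. (1 / real K) * (\<Sum>k<K. e k $ b))"
  have e: "e k \<in> carrier_vec K" for k by (simp add: e_def)
  have g: "g \<in> carrier_vec K" by (simp add: g_def)
  have FT: "transpose_mat F \<in> carrier_mat d K" using F by simp
  have "input_global_mean X K n = transpose_mat F *\<^sub>v g"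
  proof (rule eq_vecI)
    fix a assume "a < dim_vec (transpose_mat F *\<^sub>v g)"
    then have a: "a < d" using F by simp
    have "vec K (\<lambda>b. e k $ b) = e k" for k using e[of k] by (intro eq_vecI) auto
    then show "input_global_mean X K n $ a = (transpose_mat F *\<^sub>v g) $ a"
      unfolding g_def input_global_mean_def using a X
      by (simp add: mult_mat_vec_average[OF FT a] input_mean_eq_transpose e_def
          del: index_mult_mat_vec)
  qed (use F X in \<open>simp add: input_global_mean_def\<close>)
  then have "input_mean X n k - input_global_mean X K n = transpose_mat F *\<^sub>v (e k - g)"
    using mult_minus_distrib_mat_vec[OF FT e g] input_mean_eq_transpose[OF k] by (simp add: e_def)
  then show ?thesis using e g by (intro bexI[of _ "e k - g"]) auto
qed

end

section \<open>The ratio of separation measures of consecutive layers\<close>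

theorem theorem2:
  fixes K n d L :: nat and X :: "real mat" and W :: "nat \<Rightarrow> real mat" and \<epsilon> :: real
  assumes dN: "d = n * K"
    and X_carrier: "X \<in> carrier_mat d d"
    and X_orth: "transpose_mat X * X = 1\<^sub>m d"
    and L2: "L \<ge> 2"
    and W_hidden: "\<forall>l\<in>{1..L-1}. W l \<in> carrier_mat d d"
    and W_last: "W L \<in> carrier_mat K d"
    and d_gt: "d > 2 * K"
    and eps_pos: "\<epsilon> > 0"
    and eps_bound: "\<epsilon> \<le> Min {real n powr (1 / (2 * real L)) /
                                   (sqrt 30 * real L * (real d - real K) powr (1 / 4)),
                                 (real n / 2) powr (1 / (4 * real L)) / (real d - real K) powr (1 / 4),
                                 1 / sqrt (2 * (sqrt (real K) + 1))}"
    and global_opt: "Wprod d W L * X = label_mat K n"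
    and balanced: "\<forall>l\<in>{1..L-2}. transpose_mat (W (l + 1)) * W (l + 1) = W l * transpose_mat (W l)"
    and balanced_last: "frob_norm (transpose_mat (W L) * W L - W (L - 1) * transpose_mat (W (L - 1)))
                          \<le> \<epsilon>\<^sup>2 * sqrt (real d - real K)"
    and spectrum: "\<exists>A \<subseteq> {1..d}. card A = d - 2 * K \<and>
                     (\<forall>i\<in>A. \<forall>l\<in>{1..L-1}. sigma i (W l) = \<epsilon>)"
  shows "\<forall>l\<in>{0..L-2}. Dsep d W X K n (l + 1) / Dsep d W X K n l \<le> 2 * (sqrt (real K) + 1) * \<epsilon>\<^sup>2"
proof
  fix l assume "l \<in> {0..L-2}"
  then have l: "l \<le> L - 2" by simp
  have n: "n > 0" using dN d_gt by (cases n) auto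
  have eps_sq: "2 * (sqrt (real K) + 1) * \<epsilon>\<^sup>2 \<le> 1"
  proof -
    let ?a = "2 * (sqrt (real K) + 1)"
    have a: "?a > 0" by (simp add: add_nonneg_pos)
    \<comment> \<open>The third entry of the minimum; its square is
      \<open>eps_small\<close>.\<close>
    have "\<epsilon> \<le> 1 / sqrt ?a" using eps_bound by simp
    then have "\<epsilon>\<^sup>2 \<le> (1 / sqrt ?a)\<^sup>2" using eps_pos by (intro power_mono) auto
    also have "\<dots> = 1 / ?a" using a by (simp add: power_divide)
    finally show ?thesis using a by (simp add: field_simps)
  qed
  have F: "Wprod d W L \<in> carrier_mat K d"
  proof -
    have c: "Wprod d W l \<in> carrier_mat d d" if "l \<le> L - 1" for l
      using that
    proof (induction l)
      case (Suc l)
      then have "W (Suc l) \<in> carrier_mat d d" using W_hidden by simp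
      with Suc show ?case by simp
    qed simp
    show ?thesis using W_last c[of "L - 1"] L2 by (cases L) auto
  qed
  interpret balanced_network d K L n W \<epsilon>
  proof
    show "\<exists>A \<subseteq> {1..d}. card A = d - 2 * K \<and> (\<forall>i\<in>A. sigma i (W (L - 1)) = \<epsilon>)"
      using spectrum L2 by fastforce
    show "Wprod d W L * transpose_mat (Wprod d W L) = real n \<cdot>\<^sub>m 1\<^sub>m K"
      by (rule F_gram[OF dN n X_carrier X_orth F global_opt])
  qed (use assms eps_sq in auto)
  have c: "Z l \<in> carrier_mat d d" "Z (l + 1) \<in> carrier_mat d d"
    using Z_carrier[of l] Z_carrier[of "l + 1"] l L2 by auto
  define a where "a l = mtrace (Sigma_W d W X K n l)" for l
  define b where "b l = mtrace (Sigma_B d W X K n l)" for l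
  have a_nonneg: "a l \<ge> 0" "a (l + 1) \<ge> 0"
    unfolding a_def mtrace_Sigma_W[OF dN X_carrier c(1)] mtrace_Sigma_W[OF dN X_carrier c(2)]
    by (auto intro!: sum_nonneg divide_nonneg_nonneg scalar_prod_self_ge_0)
  have b_nonneg: "b l \<ge> 0"
    unfolding b_def mtrace_Sigma_B[OF dN X_carrier c(1)]
    by (auto intro!: sum_nonneg divide_nonneg_nonneg scalar_prod_self_ge_0)
  have "a (l + 1) \<le> rate * a l"
  proof -
    let ?v = "\<lambda>k i. col X (k * n + i) - input_mean X n k"
    have v: "?v k i \<in> carrier_vec d" for k i
      using X_carrier by (auto simp: input_mean_def)
    have "(\<Sum>k<K. \<Sum>i<n. (Z (l + 1) *\<^sub>v ?v k i) \<bullet> (Z (l + 1) *\<^sub>v ?v k i))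
        \<le> (\<Sum>k<K. \<Sum>i<n. rate * ((Z l *\<^sub>v ?v k i) \<bullet> (Z l *\<^sub>v ?v k i)))"
      using F_deviation[OF dN n X_carrier X_orth F global_opt]
      by (intro sum_mono within_class_decay v l) auto
    also have "\<dots> = rate * (\<Sum>k<K. \<Sum>i<n. (Z l *\<^sub>v ?v k i) \<bullet> (Z l *\<^sub>v ?v k i))"
      by (simp add: sum_distrib_left)
    finally show ?thesis
      unfolding a_def mtrace_Sigma_W[OF dN X_carrier c(1)] mtrace_Sigma_W[OF dN X_carrier c(2)] using n K_pos
      by (simp add: divide_right_mono)
  qed
  moreover have "b l \<le> b (l + 1)"
  proof -
    let ?v = "\<lambda>k. input_mean X n k - input_global_mean X K n"
    have "(Z l *\<^sub>v ?v k) \<bullet> (Z l *\<^sub>v ?v k) \<le> (Z (l + 1) *\<^sub>v ?v k) \<bullet> (Z (l + 1) *\<^sub>v ?v k)"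
      if "k < K" for k
      using centred_mean_in_range[OF dN n X_carrier X_orth F global_opt that] between_class_nondecreasing[OF _ l]
      by force
    then show ?thesis
      unfolding b_def mtrace_Sigma_B[OF dN X_carrier c(1)] mtrace_Sigma_B[OF dN X_carrier c(2)] by (intro mult_left_mono sum_mono) auto
  qed
  \<comment> \<open>Since \<open>b\<close> does not decrease, \<open>b (l + 1)\<close> is positive
    as well, and replacing it by \<open>b l\<close> only enlarges the quotient.\<close>
  ultimately have "a (l + 1) / b (l + 1) \<le> rate * (a l / b l)" if "b l > 0"
    using that a_nonneg rate_pos frac_le[of "rate * a l" "a (l + 1)" "b l" "b (l + 1)"] by simp
  then have "a (l + 1) / b (l + 1) / (a l / b l) \<le> rate"
  proof (cases "b l > 0 \<and> a l > 0")
    case True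
    then show ?thesis
      using \<open>b l > 0 \<Longrightarrow> _\<close> by (subst pos_divide_le_eq) auto
  next
    case False \<comment> \<open>one of the divisors is \<open>0\<close>, hence so is the ratio\<close>
    then show ?thesis using a_nonneg b_nonneg rate_pos by (auto simp: less_le)
  qed
  then show "Dsep d W X K n (l + 1) / Dsep d W X K n l \<le> 2 * (sqrt (real K) + 1) * \<epsilon>\<^sup>2"
    using rate_le unfolding Dsep_def a_def b_def by simp
qed

end
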